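(* Let $\alpha$ be an $E_0$-semigroup on a $\mathrm{II}_1$ factor $\mathrm{M}$ with trace $\tau$, and let $U$ be a gauge cocycle for $\alpha$. Then $U_t$ is independent of $\alpha_t(\mathrm{M})$ in the sense that $$\tau(U_t\alpha_t(x))=\tau(U_t)\,\tau(\alpha_t(x))\qquad\text{for all } x\in\mathrm{M},\ t\ge0.$$
   Context: An $E_0$-semigroup on a von Neumann algebra $\mathrm{M}$ is a semigroup $(\alpha_t)_{t\ge 0}$ of normal unital $*$-endomorphisms of $\mathrm{M}$ with $\alpha_0=\mathrm{id}$, $\alpha_t(\mathrm{M})\ne \mathrm{M}$ for all $t>0$, and $t\mapsto\rho(\alpha_t(x))$ continuous for all $x\in\mathrm{M}$, $\rho\in\mathrm{M}_*$. A cocycle for $\alpha$ is a strongly continuous family of unitaries $(U_t)_{t\ge0}$ in $\mathrm{M}$ with $U_s\alpha_s(U_t)=U_{s+t}$ for all $s,t\ge 0$. A gauge cocycle is a cocycle $U$ with $U_t\in\mathrm{M}\cap\alpha_t(\mathrm{M})'$ for all $t\ge0$. *)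

theory Defs
  imports "HOL-Analysis.Analysis"
begin

section \<open>Complex Hilbert spaces\<close>

class complex_normed_vector = real_normed_vector +
  fixes scaleC :: "complex \<Rightarrow> 'a \<Rightarrow> 'a" (infixr \<open>*\<^sub>C\<close> 75)
  assumes scaleC_add_right: "a *\<^sub>C (x + y) = a *\<^sub>C x + a *\<^sub>C y"
    and scaleC_add_left: "(a + b) *\<^sub>C x = a *\<^sub>C x + b *\<^sub>C x"
    and scaleC_scaleC: "a *\<^sub>C (b *\<^sub>C x) = (a * b) *\<^sub>C x"
    and scaleC_of_real: "complex_of_real r *\<^sub>C x = r *\<^sub>R x"
    and norm_scaleC: "norm (a *\<^sub>C x) = cmod a * norm x"

text \<open>The inner product is linear in the first and conjugate-linear in the second variable.\<close>

class complex_hilbert_space = complex_normed_vector + complete_space +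
  fixes cinner :: "'a \<Rightarrow> 'a \<Rightarrow> complex"
  assumes cinner_commute: "cinner x y = cnj (cinner y x)"
    and cinner_add_left: "cinner (x + y) z = cinner x z + cinner y z"
    and cinner_scaleC_left: "cinner (a *\<^sub>C x) y = a * cinner x y"
    and cinner_self: "cinner x x = complex_of_real ((norm x)\<^sup>2)"

section \<open>Bounded operators\<close>

text \<open>
  The type \<open>'h \<Rightarrow>\<^sub>L 'h\<close> consists of the bounded real-linear operators; the algebra
  of bounded operators on the complex Hilbert space is the subset \<open>bounded_ops\<close> below.
\<close>

instantiation blinfun :: (real_normed_vector, complex_normed_vector) complex_normed_vector
begin

lift_definition scaleC_blinfun :: "complex \<Rightarrow> 'a \<Rightarrow>\<^sub>L 'b \<Rightarrow> 'a \<Rightarrow>\<^sub>L 'b"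
  is "\<lambda>c T x. c *\<^sub>C T x"
proof -
  fix c :: complex and T :: "'a \<Rightarrow> 'b"
  assume T: "bounded_linear T"
  have commute: "c *\<^sub>C (r *\<^sub>R y) = r *\<^sub>R (c *\<^sub>C y)" for r and y :: 'b
    by (metis scaleC_of_real scaleC_scaleC mult.commute)
  have "bounded_linear (\<lambda>y::'b. c *\<^sub>C y)"
    by (rule bounded_linear_intro[where K = "cmod c"])
      (simp_all add: scaleC_add_right commute norm_scaleC mult.commute)
  then show "bounded_linear (\<lambda>x. c *\<^sub>C T x)"
    by (rule bounded_linear_compose[OF _ T])
qed

instance
proof
  fix a b :: complex and r :: real and S T :: "'a \<Rightarrow>\<^sub>L 'b"
  show "a *\<^sub>C (S + T) = a *\<^sub>C S + a *\<^sub>C T"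
    by transfer (simp add: scaleC_add_right)
  show "(a + b) *\<^sub>C T = a *\<^sub>C T + b *\<^sub>C T"
    by transfer (simp add: scaleC_add_left)
  show "a *\<^sub>C (b *\<^sub>C T) = (a * b) *\<^sub>C T"
    by transfer (simp add: scaleC_scaleC)
  show "complex_of_real r *\<^sub>C T = r *\<^sub>R T"
    by transfer (simp add: scaleC_of_real)
  have le: "norm (c *\<^sub>C R) \<le> cmod c * norm R" for c and R :: "'a \<Rightarrow>\<^sub>L 'b"
  proof (rule norm_blinfun_bound)
    fix x
    have "norm (blinfun_apply (c *\<^sub>C R) x) = cmod c * norm (blinfun_apply R x)"
      by transfer (simp add: norm_scaleC)
    also have "\<dots> \<le> cmod c * (norm R * norm x)"
      by (intro mult_left_mono norm_blinfun) simp
    finally show "norm (blinfun_apply (c *\<^sub>C R) x) \<le> cmod c * norm R * norm x"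
      by (simp add: mult.assoc)
  qed simp
  have one: "1 *\<^sub>C T = T"
    by (rule blinfun_eqI) (use scaleC_of_real[of 1, where 'a = 'b] in
        \<open>simp add: scaleC_blinfun.rep_eq\<close>)
  show "norm (a *\<^sub>C T) = cmod a * norm T"
  proof (cases "a = 0")
    case True
    then show ?thesis using le[of a T] by simp
  next
    case False
    have "inverse a *\<^sub>C (a *\<^sub>C T) = (inverse a * a) *\<^sub>C T"
      by transfer (simp add: scaleC_scaleC)
    with False one have "norm T = norm (inverse a *\<^sub>C (a *\<^sub>C T))"
      by simp
    also have "\<dots> \<le> norm (a *\<^sub>C T) / cmod a"
      using le[of "inverse a" "a *\<^sub>C T"] by (simp add: norm_inverse divide_inverse mult.commute)
    finally have "cmod a * norm T \<le> norm (a *\<^sub>C T)"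
      using False by (simp add: field_simps)
    with le[of a T] show ?thesis by simp
  qed
qed

end

definition bounded_ops :: "('h::complex_hilbert_space \<Rightarrow>\<^sub>L 'h) set" where
  "bounded_ops = {T. \<forall>c x. blinfun_apply T (c *\<^sub>C x) = c *\<^sub>C blinfun_apply T x}"

text \<open>
  For \<open>T \<in> bounded_ops\<close> the adjoint exists and is unique by the Riesz representation
  theorem; \<open>adj\<close> is only ever applied to such operators.
\<close>

definition adj :: "('h::complex_hilbert_space \<Rightarrow>\<^sub>L 'h) \<Rightarrow> ('h \<Rightarrow>\<^sub>L 'h)" where
  "adj T = (THE S. \<forall>x y. cinner (blinfun_apply T x) y = cinner x (blinfun_apply S y))"

definition unitary_op :: "('h::complex_hilbert_space \<Rightarrow>\<^sub>L 'h) \<Rightarrow> bool" where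
  "unitary_op V \<longleftrightarrow> V \<in> bounded_ops \<and>
    adj V o\<^sub>L V = id_blinfun \<and> V o\<^sub>L adj V = id_blinfun"

definition projection_op :: "('h::complex_hilbert_space \<Rightarrow>\<^sub>L 'h) \<Rightarrow> bool" where
  "projection_op p \<longleftrightarrow> p \<in> bounded_ops \<and> adj p = p \<and> p o\<^sub>L p = p"

text \<open>The ultraweak (\<open>\<sigma>\<close>-weak) topology.\<close>

definition square_summable :: "(nat \<Rightarrow> 'h::complex_hilbert_space) \<Rightarrow> bool" where
  "square_summable \<xi> \<longleftrightarrow> summable (\<lambda>n. (norm (\<xi> n))\<^sup>2)"

definition ultraweak :: "('h::complex_hilbert_space \<Rightarrow>\<^sub>L 'h) topology" where
  "ultraweak = topology_generated_by
    {{T. (\<Sum>n. cinner (blinfun_apply T (\<xi> n)) (\<eta> n)) \<in> V} | \<xi> \<eta> V.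
      square_summable \<xi> \<and> square_summable \<eta> \<and> open V}"

section \<open>Von Neumann algebras and II$_1$ factors\<close>

definition commutant ::
    "('h::complex_hilbert_space \<Rightarrow>\<^sub>L 'h) set \<Rightarrow> ('h \<Rightarrow>\<^sub>L 'h) set" where
  "commutant S = {T \<in> bounded_ops. \<forall>A\<in>S. T o\<^sub>L A = A o\<^sub>L T}"

definition von_neumann_algebra :: "('h::complex_hilbert_space \<Rightarrow>\<^sub>L 'h) set \<Rightarrow> bool" where
  "von_neumann_algebra M \<longleftrightarrow>
    M \<subseteq> bounded_ops \<and> (\<forall>x\<in>M. adj x \<in> M) \<and> commutant (commutant M) = M"

definition factor :: "('h::complex_hilbert_space \<Rightarrow>\<^sub>L 'h) set \<Rightarrow> bool" where
  "factor M \<longleftrightarrow> von_neumann_algebra M \<and> (id_blinfun :: 'h \<Rightarrow>\<^sub>L 'h) \<noteq> 0 \<and>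
    M \<inter> commutant M = range (\<lambda>c. c *\<^sub>C id_blinfun)"

text \<open>For projections, \<open>q \<le> p\<close> is expressed by \<open>p q = q\<close>.\<close>

definition minimal_projection ::
    "('h::complex_hilbert_space \<Rightarrow>\<^sub>L 'h) set \<Rightarrow> ('h \<Rightarrow>\<^sub>L 'h) \<Rightarrow> bool" where
  "minimal_projection M p \<longleftrightarrow> p \<in> M \<and> projection_op p \<and> p \<noteq> 0 \<and>
    (\<forall>q\<in>M. projection_op q \<and> p o\<^sub>L q = q \<longrightarrow> q = 0 \<or> q = p)"

definition finite_vna :: "('h::complex_hilbert_space \<Rightarrow>\<^sub>L 'h) set \<Rightarrow> bool" where
  "finite_vna M \<longleftrightarrow>
    (\<forall>v\<in>M. adj v o\<^sub>L v = id_blinfun \<longrightarrow> v o\<^sub>L adj v = id_blinfun)"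

definition II1_factor :: "('h::complex_hilbert_space \<Rightarrow>\<^sub>L 'h) set \<Rightarrow> bool" where
  "II1_factor M \<longleftrightarrow> factor M \<and> finite_vna M \<and> (\<nexists>p. minimal_projection M p)"

definition linear_functional_on ::
    "('h::complex_hilbert_space \<Rightarrow>\<^sub>L 'h) set \<Rightarrow> (('h \<Rightarrow>\<^sub>L 'h) \<Rightarrow> complex) \<Rightarrow> bool" where
  "linear_functional_on M \<rho> \<longleftrightarrow>
    (\<forall>x\<in>M. \<forall>y\<in>M. \<rho> (x + y) = \<rho> x + \<rho> y) \<and> (\<forall>c. \<forall>x\<in>M. \<rho> (c *\<^sub>C x) = c * \<rho> x)"

text \<open>The predual \<open>M\<^sub>*\<close>; only the values of a functional on \<open>M\<close> are relevant.\<close>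

definition predual ::
    "('h::complex_hilbert_space \<Rightarrow>\<^sub>L 'h) set \<Rightarrow> (('h \<Rightarrow>\<^sub>L 'h) \<Rightarrow> complex) set" where
  "predual M = {\<rho>. linear_functional_on M \<rho> \<and>
    continuous_map (subtopology ultraweak M) euclidean \<rho>}"

text \<open>
  The trace of a II$_1$ factor is its faithful normal tracial state; it is unique.
\<close>

definition trace_on ::
    "('h::complex_hilbert_space \<Rightarrow>\<^sub>L 'h) set \<Rightarrow> (('h \<Rightarrow>\<^sub>L 'h) \<Rightarrow> complex) \<Rightarrow> bool" where
  "trace_on M \<tau> \<longleftrightarrow> \<tau> \<in> predual M \<and> \<tau> id_blinfun = 1 \<and>
    (\<forall>x\<in>M. Im (\<tau> (adj x o\<^sub>L x)) = 0 \<and> 0 \<le> Re (\<tau> (adj x o\<^sub>L x))) \<and>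
    (\<forall>x\<in>M. \<tau> (adj x o\<^sub>L x) = 0 \<longrightarrow> x = 0) \<and>
    (\<forall>x\<in>M. \<forall>y\<in>M. \<tau> (x o\<^sub>L y) = \<tau> (y o\<^sub>L x))"

section \<open>$E_0$-semigroups and gauge cocycles\<close>

definition normal_unital_star_endomorphism ::
    "('h::complex_hilbert_space \<Rightarrow>\<^sub>L 'h) set \<Rightarrow> (('h \<Rightarrow>\<^sub>L 'h) \<Rightarrow> ('h \<Rightarrow>\<^sub>L 'h)) \<Rightarrow> bool" where
  "normal_unital_star_endomorphism M \<theta> \<longleftrightarrow>
    (\<forall>x\<in>M. \<theta> x \<in> M) \<and>
    (\<forall>x\<in>M. \<forall>y\<in>M. \<theta> (x + y) = \<theta> x + \<theta> y) \<and>
    (\<forall>c. \<forall>x\<in>M. \<theta> (c *\<^sub>C x) = c *\<^sub>C \<theta> x) \<and>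
    (\<forall>x\<in>M. \<forall>y\<in>M. \<theta> (x o\<^sub>L y) = \<theta> x o\<^sub>L \<theta> y) \<and>
    (\<forall>x\<in>M. \<theta> (adj x) = adj (\<theta> x)) \<and>
    \<theta> id_blinfun = id_blinfun \<and>
    continuous_map (subtopology ultraweak M) (subtopology ultraweak M) \<theta>"

definition E0_semigroup ::
    "('h::complex_hilbert_space \<Rightarrow>\<^sub>L 'h) set \<Rightarrow>
      (real \<Rightarrow> ('h \<Rightarrow>\<^sub>L 'h) \<Rightarrow> ('h \<Rightarrow>\<^sub>L 'h)) \<Rightarrow> bool" where
  "E0_semigroup M \<alpha> \<longleftrightarrow>
    (\<forall>t\<ge>0. normal_unital_star_endomorphism M (\<alpha> t)) \<and>
    (\<forall>x\<in>M. \<alpha> 0 x = x) \<and>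
    (\<forall>s\<ge>0. \<forall>t\<ge>0. \<forall>x\<in>M. \<alpha> s (\<alpha> t x) = \<alpha> (s + t) x) \<and>
    (\<forall>t>0. \<alpha> t ` M \<noteq> M) \<and>
    (\<forall>x\<in>M. \<forall>\<rho>\<in>predual M. continuous_on {0..} (\<lambda>t. \<rho> (\<alpha> t x)))"

definition cocycle ::
    "('h::complex_hilbert_space \<Rightarrow>\<^sub>L 'h) set \<Rightarrow>
      (real \<Rightarrow> ('h \<Rightarrow>\<^sub>L 'h) \<Rightarrow> ('h \<Rightarrow>\<^sub>L 'h)) \<Rightarrow> (real \<Rightarrow> ('h \<Rightarrow>\<^sub>L 'h)) \<Rightarrow> bool" where
  "cocycle M \<alpha> U \<longleftrightarrow>
    (\<forall>t\<ge>0. U t \<in> M \<and> unitary_op (U t)) \<and>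
    (\<forall>v. continuous_on {0..} (\<lambda>t. blinfun_apply (U t) v)) \<and>
    (\<forall>s\<ge>0. \<forall>t\<ge>0. U s o\<^sub>L \<alpha> s (U t) = U (s + t))"

definition gauge_cocycle ::
    "('h::complex_hilbert_space \<Rightarrow>\<^sub>L 'h) set \<Rightarrow>
      (real \<Rightarrow> ('h \<Rightarrow>\<^sub>L 'h) \<Rightarrow> ('h \<Rightarrow>\<^sub>L 'h)) \<Rightarrow> (real \<Rightarrow> ('h \<Rightarrow>\<^sub>L 'h)) \<Rightarrow> bool" where
  "gauge_cocycle M \<alpha> U \<longleftrightarrow>
    cocycle M \<alpha> U \<and> (\<forall>t\<ge>0. U t \<in> M \<inter> commutant (\<alpha> t ` M))"

end

theory Submission
  imports Defs
begin

text \<open>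
  As \<open>U\<^sub>t\<close> commutes with \<open>\<alpha>\<^sub>t(M)\<close>, the map \<open>x \<mapsto> \<tau>(U\<^sub>t \<alpha>\<^sub>t(x))\<close> is a normal tracial functional
  on \<open>M\<close>, and so is \<open>\<tau> \<circ> \<alpha>\<^sub>t\<close>. Both are therefore multiples of \<open>\<tau>\<close>, and evaluation at \<open>1\<close>
  determines the factors.

  To see that a normal tracial \<open>\<psi>\<close> is a multiple of \<open>\<tau>\<close>, fix \<open>x\<close> and consider the set \<open>K\<close> of all
  \<open>y \<in> M\<close> with \<open>\<parallel>y\<parallel> \<le> \<parallel>x\<parallel>\<close>, \<open>\<psi>(y) = \<psi>(x)\<close> and \<open>\<tau>(y) = \<tau>(x)\<close>. It is convex, ultraweakly compact and
  invariant under unitary conjugation, and \<open>y \<mapsto> \<tau>(y\<^sup>* y)\<close> is ultraweakly lower semicontinuous on it.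
  By the parallelogram law the minimizer is unique, so it commutes with all unitaries of \<open>M\<close>.
  In a factor it is then a scalar \<open>c\<close>, whence \<open>\<tau>(x) = c\<close> and \<open>\<psi>(x) = c \<psi>(1)\<close>.
\<close>

text \<open>This makes the operator type \<open>'h \<Rightarrow>\<^sub>L 'h\<close> a Banach space,
  as the fixed point construction of the resolvent requires.\<close>

instance complex_hilbert_space \<subseteq> banach ..

section \<open>Arithmetic of complex scalars\<close>

lemma scaleC_zero_left [simp]: "0 *\<^sub>C x = (0 :: 'a::complex_normed_vector)"
  using norm_scaleC[of 0 x] by simp

lemma scaleC_one [simp]: "1 *\<^sub>C x = (x :: 'a::complex_normed_vector)"
  using scaleC_of_real[of 1 x] by simp

lemma scaleC_minus_one: "(- 1) *\<^sub>C x = - (x :: 'a::complex_normed_vector)"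
  using scaleC_of_real[of "- 1" x] by simp

lemma scaleC_minus_left [simp]: "(- a) *\<^sub>C x = - (a *\<^sub>C (x :: 'a::complex_normed_vector))"
  by (metis scaleC_minus_one scaleC_scaleC mult_minus_left mult_1)

lemma scaleC_minus_right [simp]: "a *\<^sub>C (- x) = - (a *\<^sub>C (x :: 'a::complex_normed_vector))"
  by (metis scaleC_minus_one scaleC_scaleC mult.commute)

lemma scaleC_diff_right: "a *\<^sub>C (x - y) = a *\<^sub>C x - a *\<^sub>C (y :: 'a::complex_normed_vector)"
  using scaleC_add_right[of a x "- y"] by simp

lemma blinfun_apply_scaleC [simp]:
  "blinfun_apply (c *\<^sub>C T) x = c *\<^sub>C blinfun_apply T x"
  by (simp add: scaleC_blinfun.rep_eq)

section \<open>Inner products and the Riesz representation theorem\<close>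

lemma cinner_add_right: "cinner x (y + z) = cinner x y + cinner x z"
  by (metis cinner_add_left cinner_commute complex_cnj_add)

lemma cinner_scaleC_right: "cinner x (a *\<^sub>C y) = cnj a * cinner x y"
  by (metis cinner_commute cinner_scaleC_left complex_cnj_mult)

lemma cinner_zero_left [simp]: "cinner 0 y = 0"
  using cinner_add_left[of 0 0 y] by simp

lemma cinner_zero_right [simp]: "cinner x 0 = 0"
  using cinner_add_right[of x 0 0] by simp

lemma cinner_minus_left: "cinner (- x) y = - cinner x y"
  by (metis cinner_scaleC_left mult_minus1 scaleC_minus_one)

lemma cinner_minus_right: "cinner x (- y) = - cinner x y"
  by (metis cinner_commute cinner_minus_left complex_cnj_minus)

lemma cinner_diff_right: "cinner x (y - z) = cinner x y - cinner x z"
  using cinner_add_right[of x y "- z"] by (simp add: cinner_minus_right)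

lemma cinner_scaleR_right: "cinner x (r *\<^sub>R y) = r * cinner x y"
  by (metis cinner_scaleC_right scaleC_of_real complex_cnj_complex_of_real)

lemma norm_add_square:
  "(norm (x + y))\<^sup>2 = (norm x)\<^sup>2 + (norm (y :: 'h::complex_hilbert_space))\<^sup>2 + 2 * Re (cinner x y)"
proof -
  have "complex_of_real ((norm (x + y))\<^sup>2) =
      complex_of_real ((norm x)\<^sup>2) + complex_of_real ((norm y)\<^sup>2) + (cinner x y + cnj (cinner x y))"
    unfolding cinner_self[symmetric] cinner_add_left cinner_add_right
    using cinner_commute[of y x] by simp
  then show ?thesis
    using complex_add_cnj[of "cinner x y"] by (metis of_real_add of_real_eq_iff)
qed

lemma norm_diff_square:
  "(norm (x - y))\<^sup>2 = (norm x)\<^sup>2 + (norm (y :: 'h::complex_hilbert_space))\<^sup>2 - 2 * Re (cinner x y)"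
  using norm_add_square[of x "- y"] by (simp add: cinner_minus_right)

text \<open>The norm is a primitive of the class, so Cauchy-Schwarz is derived from the triangle
  inequality by squaring it and comparing cross terms.\<close>

lemma Re_cinner_le: "Re (cinner x y) \<le> norm x * norm (y :: 'h::complex_hilbert_space)"
proof -
  have "(norm (x + y))\<^sup>2 \<le> (norm x + norm y)\<^sup>2"
    by (intro power_mono norm_triangle_ineq) simp
  then show ?thesis unfolding norm_add_square power2_sum by simp
qed

lemma cmod_cinner_le: "cmod (cinner x y) \<le> norm x * norm (y :: 'h::complex_hilbert_space)"
proof (cases "cinner x y = 0")
  case False
  \<comment> \<open>The phase that rotates \<open>cinner x y\<close> onto the nonnegative real axis;
    this reduces the claim to the bound on the real part.\<close>
  define a where "a = cnj (sgn (cinner x y))"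
  have a: "cmod a = 1" using False by (simp add: a_def norm_sgn)
  have "a * cinner x y = cmod (cinner x y)"
    using False complex_norm_square[of "cinner x y"]
    by (simp add: a_def sgn_eq mult.commute divide_simps power2_eq_square)
  then have "cmod (cinner x y) = Re (cinner (a *\<^sub>C x) y)"
    by (simp add: cinner_scaleC_left)
  also have "\<dots> \<le> norm x * norm y"
    using Re_cinner_le[of "a *\<^sub>C x" y] a by (simp add: norm_scaleC)
  finally show ?thesis .
qed simp

lemma cinner_left_cong: "(\<And>x. cinner x y = cinner x z) \<Longrightarrow> y = z"
  by (metis cinner_diff_right cinner_self diff_self norm_eq_zero of_real_eq_0_iff
      right_minus_eq zero_eq_power2)

lemma cinner_right_cong: "(\<And>y. cinner x y = cinner z y) \<Longrightarrow> x = z"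
  by (metis cinner_commute cinner_left_cong)

text \<open>The Riesz vector of \<open>f\<close> is the minimizer of \<open>\<parallel>x\<parallel>\<^sup>2 - 2 Re f(x)\<close>.\<close>

lemma riesz_minimizer:
  fixes f :: "'h::complex_hilbert_space \<Rightarrow> complex"
  assumes add: "\<And>x y. f (x + y) = f x + f y"
    and scale: "\<And>c x. f (c *\<^sub>C x) = c * f x"
    and bound: "\<And>x. cmod (f x) \<le> K * norm x"
  obtains w where "\<And>x. (norm w)\<^sup>2 - 2 * Re (f w) \<le> (norm x)\<^sup>2 - 2 * Re (f x)"
proof -
  define g where "g x = (norm x)\<^sup>2 - 2 * Re (f x)" for x
  have scaleR: "f (r *\<^sub>R x) = r * f x" for r x
    by (metis scale scaleC_of_real)
  have diff: "f (x - y) = f x - f y" for x y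
    using add[of x "- y"] scaleR[of "- 1" y] by simp
  \<comment> \<open>Completing the square in \<open>norm x - K\<close> gives the lower
    bound.\<close>
  have g_lower: "- (K\<^sup>2) \<le> g x" for x
  proof -
    have "Re (f x) \<le> K * norm x"
      using bound[of x] complex_Re_le_cmod[of "f x"] by linarith
    moreover have "0 \<le> (norm x - K)\<^sup>2" by simp
    ultimately show ?thesis unfolding g_def power2_diff by (simp add: algebra_simps)
  qed
  define m where "m = (INF x. g x)"
  have bdd: "bdd_below (range g)" using g_lower by (intro bdd_belowI) auto
  have m_le: "m \<le> g x" for x unfolding m_def by (intro cINF_lower bdd) simp
  \<comment> \<open>The parallelogram law; the linear terms of \<open>g\<close> cancel. As
    \<open>g\<close> is at least \<open>m\<close> at the midpoint, two almost minimal points must be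
    close, so a minimizing sequence is Cauchy.\<close>
  have par: "(norm (x - y))\<^sup>2 = 2 * g x + 2 * g y - 4 * g ((1/2) *\<^sub>R (x + y))" for x y
    unfolding g_def scaleR add norm_scaleR power_mult_distrib norm_add_square norm_diff_square
    by (simp add: power2_eq_square algebra_simps)
  have "\<exists>x. g x < m + 1 / real (Suc n)" for n
  proof -
    have "Inf (range g) < m + 1 / real (Suc n)" unfolding m_def by simp
    then show ?thesis using cInf_less_iff[OF _ bdd] by auto
  qed
  then obtain X where X: "\<And>n. g (X n) < m + 1 / real (Suc n)" by metis
  have dist: "(norm (X i - X j))\<^sup>2 \<le> 4 / real (Suc n)" if "n \<le> i" "n \<le> j" for n i j
  proof -
    have "1 / real (Suc i) \<le> 1 / real (Suc n)" "1 / real (Suc j) \<le> 1 / real (Suc n)"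
      using that by (auto intro!: divide_left_mono)
    then show ?thesis
      using par[of "X i" "X j"] X[of i] X[of j] m_le[of "(1/2) *\<^sub>R (X i + X j)"] by simp
  qed
  have "Cauchy X"
  proof (rule CauchyI)
    fix e :: real assume "0 < e"
    then obtain n where n: "4 / e\<^sup>2 < real n" using reals_Archimedean2 by blast
    show "\<exists>M. \<forall>i\<ge>M. \<forall>j\<ge>M. norm (X i - X j) < e"
    proof (intro exI allI impI)
      fix i j assume "n \<le> i" "n \<le> j"
      have "4 / real (Suc n) < e\<^sup>2"
        using n \<open>0 < e\<close> by (simp add: field_simps) (smt (verit) zero_less_power)
      with dist[OF \<open>n \<le> i\<close> \<open>n \<le> j\<close>] have "(norm (X i - X j))\<^sup>2 < e\<^sup>2" by simp
      then show "norm (X i - X j) < e" using \<open>0 < e\<close> power2_less_imp_less by fastforce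
    qed
  qed
  then obtain w where w: "X \<longlonglongrightarrow> w" using Cauchy_convergent convergentD by blast
  have bl: "bounded_linear f"
    by (rule bounded_linear_intro[where K = K]) (auto simp: add scaleR bound mult.commute scaleR_conv_of_real)
  have "(\<lambda>n. g (X n)) \<longlonglongrightarrow> g w"
    unfolding g_def by (intro tendsto_intros w bounded_linear.tendsto[OF bl])
  moreover have "(\<lambda>n. m + 1 / real (Suc n)) \<longlonglongrightarrow> m + 0"
    by (intro tendsto_add tendsto_const LIMSEQ_Suc[OF lim_1_over_n])
  ultimately have "g w \<le> m + 0"
    using X by (intro LIMSEQ_le[where X = "\<lambda>n. g (X n)"]) (auto intro: less_imp_le)
  then have "g w \<le> g x" for x using m_le[of x] by simp
  then show ?thesis using that[of w] unfolding g_def by blast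
qed

theorem riesz:
  fixes f :: "'h::complex_hilbert_space \<Rightarrow> complex"
  assumes add: "\<And>x y. f (x + y) = f x + f y"
    and scale: "\<And>c x. f (c *\<^sub>C x) = c * f x"
    and bound: "\<And>x. cmod (f x) \<le> K * norm x" and "0 \<le> K"
  obtains w where "\<And>x. f x = cinner x w" "norm w \<le> K"
proof -
  obtain w where w: "\<And>x. (norm w)\<^sup>2 - 2 * Re (f w) \<le> (norm x)\<^sup>2 - 2 * Re (f x)"
    using riesz_minimizer[OF add scale bound] by blast
  \<comment> \<open>First variation: moving from \<open>w\<close> to
    \<open>w + t *\<^sub>R x\<close> changes the minimized functional by the quadratic in
    \<open>ineq\<close>, which can be nonnegative for all real \<open>t\<close> only if its linear
    coefficient \<open>d\<close> vanishes.\<close>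
  have Re_eq: "Re (f x) = Re (cinner x w)" for x
  proof -
    define d where "d = Re (cinner x w) - Re (f x)"
    have ineq: "0 \<le> 2 * t * d + t\<^sup>2 * (norm x)\<^sup>2" for t :: real
    proof -
      have "f (t *\<^sub>R x) = t * f x" by (metis scale scaleC_of_real)
      moreover have "cinner w (t *\<^sub>R x) = t * cnj (cinner x w)"
        by (metis cinner_scaleR_right cinner_commute)
      ultimately show ?thesis
        using w[of "w + t *\<^sub>R x"]
        by (simp add: norm_add_square add d_def power_mult_distrib algebra_simps)
    qed
    show ?thesis
    proof (rule ccontr)
      assume "\<not> ?thesis"
      then have "d \<noteq> 0" by (simp add: d_def)
      \<comment> \<open>The summand 1 keeps \<open>N\<close> positive even for \<open>x = 0\<close>.
        At \<open>t = - d / N\<close> the quadratic is at most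
        \<open>- d\<^sup>2 / N\<close>.\<close>
      define N where "N = (norm x)\<^sup>2 + 1"
      have N: "0 < N" "(norm x)\<^sup>2 < N" by (auto simp: N_def add_nonneg_pos)
      have "0 \<le> - 2 * d\<^sup>2 / N + d\<^sup>2 / N\<^sup>2 * (norm x)\<^sup>2"
        using ineq[of "- d / N"] by (simp add: power2_eq_square)
      also have "\<dots> \<le> - 2 * d\<^sup>2 / N + d\<^sup>2 / N\<^sup>2 * N"
        using N by (intro add_left_mono mult_left_mono) auto
      also have "\<dots> = - (d\<^sup>2 / N)" using N by (simp add: power2_eq_square)
      finally show False using \<open>d \<noteq> 0\<close> N by (simp add: divide_simps)
    qed
  qed
  \<comment> \<open>Replacing \<open>x\<close> by \<open>\<i> *\<^sub>C x\<close> turns real parts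
    into imaginary parts.\<close>
  have eq: "f x = cinner x w" for x
    using Re_eq[of x] Re_eq[of "\<i> *\<^sub>C x"]
    by (intro complex_eqI) (auto simp: scale cinner_scaleC_left)
  have "(norm w)\<^sup>2 \<le> K * norm w"
    using bound[of w] by (simp add: eq cinner_self norm_power)
  then have "norm w \<le> K"
    using \<open>0 \<le> K\<close> by (cases "norm w = 0") (auto simp: power2_eq_square)
  then show ?thesis using that eq by blast
qed

section \<open>Bounded operators and adjoints\<close>

lemma bounded_opsD: "T \<in> bounded_ops \<Longrightarrow> blinfun_apply T (c *\<^sub>C x) = c *\<^sub>C blinfun_apply T x"
  by (simp add: bounded_ops_def)

lemma blinfun_sesquilinear_eqI:
  fixes S T :: "'h::complex_hilbert_space \<Rightarrow>\<^sub>L 'h"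
  shows "(\<And>x y. cinner (blinfun_apply S x) y = cinner (blinfun_apply T x) y) \<Longrightarrow> S = T"
  by (intro blinfun_eqI cinner_right_cong)

text \<open>The Riesz vector of \<open>B\<close> in the first variable, with \<open>y\<close> fixed,
  is unique and hence depends linearly on \<open>y\<close>. This serves both for adjoints and for
  recovering operators from forms.\<close>

lemma riesz_operator:
  fixes B :: "'h::complex_hilbert_space \<Rightarrow> 'h \<Rightarrow> complex"
  assumes "\<And>x y z. B (x + y) z = B x z + B y z" "\<And>c x z. B (c *\<^sub>C x) z = c * B x z"
    and "\<And>x y z. B z (x + y) = B z x + B z y" "\<And>c x z. B z (c *\<^sub>C x) = cnj c * B z x"
    and bound: "\<And>x y. cmod (B x y) \<le> K * norm x * norm y" and K: "0 \<le> K"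
  obtains S where "S \<in> bounded_ops" "norm S \<le> K"
    "\<And>x y. B x y = cinner x (blinfun_apply S y)"
proof -
  have "\<exists>w. (\<forall>x. B x y = cinner x w) \<and> norm w \<le> K * norm y" for y
    by (rule riesz[of "\<lambda>x. B x y" "K * norm y"])
      (use bound[of _ y] K assms(1,2) in \<open>auto simp: mult_ac\<close>)
  then obtain s where s: "\<And>x y. B x y = cinner x (s y)" "\<And>y. norm (s y) \<le> K * norm y"
    by metis
  have add: "s (x + y) = s x + s y" for x y
    by (rule cinner_left_cong) (simp add: cinner_add_right s(1)[symmetric] assms)
  have scale: "s (c *\<^sub>C x) = c *\<^sub>C s x" for c x
    by (rule cinner_left_cong) (simp add: cinner_scaleC_right s(1)[symmetric] assms)
  have bl: "bounded_linear s"
    by (rule bounded_linear_intro[where K = K])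
      (auto simp: add s(2) mult.commute[of _ K] scaleC_of_real[symmetric] scale)
  have app: "blinfun_apply (Blinfun s) = s" by (rule bounded_linear_Blinfun_apply[OF bl])
  show ?thesis
  proof (rule that[of "Blinfun s"])
    show "Blinfun s \<in> bounded_ops" by (simp add: bounded_ops_def app scale)
    show "norm (Blinfun s) \<le> K" by (rule norm_blinfun_bound[OF K]) (simp add: app s(2))
  qed (simp add: app s(1))
qed

lemma cinner_blinfun_bound:
  "cmod (cinner (blinfun_apply T x) y) \<le> norm T * norm x * norm (y :: 'h::complex_hilbert_space)"
  by (meson cmod_cinner_le mult_right_mono norm_blinfun norm_ge_zero order_trans)

lemma adjI:
  assumes "\<And>x y. cinner (blinfun_apply T x) y = cinner x (blinfun_apply S y)"
  shows "adj T = S"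
  unfolding adj_def
proof (rule the_equality)
  fix S' assume "\<forall>x y. cinner (blinfun_apply T x) y = cinner x (blinfun_apply S' y)"
  then show "S' = S" by (intro blinfun_eqI cinner_left_cong) (simp flip: assms)
qed (use assms in blast)

text \<open>As \<open>adj\<close> is a definite description, existence has to come from the operator
  of the form \<open>cinner (blinfun_apply T x) y\<close>; uniqueness is in
  \<open>adjI\<close>.\<close>

lemma adj_works:
  assumes "T \<in> bounded_ops"
  shows "adj T \<in> bounded_ops" "cinner (blinfun_apply T x) y = cinner x (blinfun_apply (adj T) y)"
proof -
  obtain S where S: "S \<in> bounded_ops"
    "\<And>x y. cinner (blinfun_apply T x) y = cinner x (blinfun_apply S y)"
  proof (rule riesz_operator[of "\<lambda>x y. cinner (blinfun_apply T x) y" "norm T"])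
    show "cmod (cinner (blinfun_apply T x) y) \<le> norm T * norm x * norm y" for x y
      by (rule cinner_blinfun_bound)
  qed (use bounded_opsD[OF assms] in \<open>auto simp: blinfun.add_right cinner_add_left cinner_add_right
       cinner_scaleC_left cinner_scaleC_right\<close>)
  have "adj T = S" by (rule adjI[OF S(2)])
  with S show "adj T \<in> bounded_ops"
    "cinner (blinfun_apply T x) y = cinner x (blinfun_apply (adj T) y)" by auto
qed

lemma cinner_adj_left:
  "T \<in> bounded_ops \<Longrightarrow> cinner (blinfun_apply (adj T) x) y = cinner x (blinfun_apply T y)"
  by (metis adj_works(2) cinner_commute)

lemma adj_adj: "T \<in> bounded_ops \<Longrightarrow> adj (adj T) = T"
  by (rule adjI) (rule cinner_adj_left)

lemma adj_compose:
  "S \<in> bounded_ops \<Longrightarrow> T \<in> bounded_ops \<Longrightarrow> adj (S o\<^sub>L T) = adj T o\<^sub>L adj S"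
  by (rule adjI) (simp add: adj_works(2))

lemma adj_add: "S \<in> bounded_ops \<Longrightarrow> T \<in> bounded_ops \<Longrightarrow> adj (S + T) = adj S + adj T"
  by (rule adjI) (simp add: adj_works(2) blinfun.add_left cinner_add_left cinner_add_right)

lemma adj_scaleC: "T \<in> bounded_ops \<Longrightarrow> adj (c *\<^sub>C T) = cnj c *\<^sub>C adj T"
  by (rule adjI) (simp add: adj_works(2) cinner_scaleC_left cinner_scaleC_right)

lemma adj_id: "adj id_blinfun = (id_blinfun :: 'h::complex_hilbert_space \<Rightarrow>\<^sub>L 'h)"
  by (rule adjI) simp

section \<open>The ultraweak topology\<close>

lemma topspace_ultraweak [simp]: "topspace ultraweak = (UNIV :: ('h::complex_hilbert_space \<Rightarrow>\<^sub>L 'h) set)"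
proof -
  \<comment> \<open>With zero sequences and \<open>V = UNIV\<close> the whole space is itself a
    subbasic set.\<close>
  have "square_summable (\<lambda>n. 0 :: 'h)" by (simp add: square_summable_def)
  then have "(UNIV :: ('h \<Rightarrow>\<^sub>L 'h) set) \<in> {{T. (\<Sum>n. cinner (blinfun_apply T (\<xi> n)) (\<eta> n)) \<in> V} | \<xi> \<eta> V.
      square_summable \<xi> \<and> square_summable \<eta> \<and> open V}"
    by (auto intro!: exI[of _ "\<lambda>n. 0 :: 'h"] exI[of _ UNIV])
  then show ?thesis unfolding ultraweak_def topology_generated_by_topspace
    by (intro equalityI subset_UNIV Union_upper)
qed

lemma continuous_map_ultraweak_functional:
  fixes \<xi> \<eta> :: "nat \<Rightarrow> 'h::complex_hilbert_space"
  assumes "square_summable \<xi>" "square_summable \<eta>"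
  shows "continuous_map ultraweak euclidean (\<lambda>T. \<Sum>n. cinner (blinfun_apply T (\<xi> n)) (\<eta> n))"
  unfolding continuous_map_def
proof (intro conjI allI impI)
  fix V :: "complex set" assume "openin euclidean V"
  then have "openin ultraweak {T. (\<Sum>n. cinner (blinfun_apply T (\<xi> n)) (\<eta> n)) \<in> V}"
    unfolding ultraweak_def using assms by (intro topology_generated_by_Basis) auto
  then show "openin ultraweak
      {T \<in> topspace ultraweak. (\<Sum>n. cinner (blinfun_apply T (\<xi> n)) (\<eta> n)) \<in> V}"
    by simp
qed auto

lemma continuous_map_ultraweak_cinner:
  fixes x y :: "'h::complex_hilbert_space"
  shows "continuous_map ultraweak euclidean (\<lambda>T. cinner (blinfun_apply T x) y)"
proof -
  \<comment> \<open>Sequences supported at index 0 reduce the series to one matrix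
    coefficient.\<close>
  define e :: "'h \<Rightarrow> nat \<Rightarrow> 'h" where "e v n = (if n = 0 then v else 0)" for v n
  have "square_summable (e v)" for v
    unfolding square_summable_def
    by (rule summable_finite[of "{0}"]) (auto simp: e_def)
  then have "continuous_map ultraweak euclidean (\<lambda>T. \<Sum>n. cinner (blinfun_apply T (e x n)) (e y n))"
    by (intro continuous_map_ultraweak_functional)
  moreover have "(\<Sum>n. cinner (blinfun_apply T (e x n)) (e y n)) = cinner (blinfun_apply T x) y"
    for T :: "'h \<Rightarrow>\<^sub>L 'h"
    by (subst suminf_finite[of "{0}"]) (auto simp: e_def)
  ultimately show ?thesis by simp
qed

text \<open>The topology is generated by preimages under these functionals, so it suffices to pull
  back subbasic sets.\<close>

lemma continuous_map_into_ultraweak: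
  fixes f :: "'a \<Rightarrow> 'h::complex_hilbert_space \<Rightarrow>\<^sub>L 'h"
  assumes "\<And>\<xi> \<eta>. square_summable \<xi> \<Longrightarrow> square_summable \<eta> \<Longrightarrow>
    continuous_map X euclidean (\<lambda>a. \<Sum>n. cinner (blinfun_apply (f a) (\<xi> n)) (\<eta> n))"
  shows "continuous_map X ultraweak f"
  unfolding ultraweak_def
proof (rule continuous_on_generated_topo)
  fix W :: "('h \<Rightarrow>\<^sub>L 'h) set"
  assume "W \<in> {{T. (\<Sum>n. cinner (blinfun_apply T (\<xi> n)) (\<eta> n)) \<in> V} | \<xi> \<eta> V.
      square_summable \<xi> \<and> square_summable \<eta> \<and> open V}"
  then obtain \<xi> \<eta> :: "nat \<Rightarrow> 'h" and V where
    W: "W = {T. (\<Sum>n. cinner (blinfun_apply T (\<xi> n)) (\<eta> n)) \<in> V}"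
      and "square_summable \<xi>" "square_summable \<eta>" "open V" by auto
  then have "openin X {a \<in> topspace X. (\<Sum>n. cinner (blinfun_apply (f a) (\<xi> n)) (\<eta> n)) \<in> V}"
    using openin_continuous_map_preimage[OF assms] by auto
  also have "{a \<in> topspace X. (\<Sum>n. cinner (blinfun_apply (f a) (\<xi> n)) (\<eta> n)) \<in> V} =
      f -` W \<inter> topspace X"
    unfolding W by auto
  finally show "openin X (f -` W \<inter> topspace X)" .
next
  show "f ` topspace X \<subseteq> \<Union> {{T. (\<Sum>n. cinner (blinfun_apply T (\<xi> n)) (\<eta> n)) \<in> V} | \<xi> \<eta> V.
      square_summable \<xi> \<and> square_summable \<eta> \<and> open V}"
    using topspace_ultraweak[where 'h = 'h, unfolded ultraweak_def topology_generated_by_topspace]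
    by simp
qed

lemma square_summable_blinfun:
  assumes "square_summable \<eta>"
  shows "square_summable (\<lambda>n. blinfun_apply A (\<eta> n))"
  unfolding square_summable_def
proof (rule summable_comparison_test'[of "\<lambda>n. (norm A)\<^sup>2 * (norm (\<eta> n))\<^sup>2" 0])
  show "summable (\<lambda>n. (norm A)\<^sup>2 * (norm (\<eta> n))\<^sup>2)"
    using assms unfolding square_summable_def by (rule summable_mult)
  show "norm ((norm (blinfun_apply A (\<eta> n)))\<^sup>2) \<le> (norm A)\<^sup>2 * (norm (\<eta> n))\<^sup>2" for n
    using power_mono[OF norm_blinfun[of A "\<eta> n"], of 2] by (simp add: power_mult_distrib)
qed

text \<open>By the inequality of arithmetic and geometric means. The series is the majorant in the
  Weierstrass test below.\<close>

lemma summable_norm_mult: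
  assumes "square_summable \<xi>" "square_summable \<eta>"
  shows "summable (\<lambda>n. norm (\<xi> n) * norm (\<eta> n))"
proof (rule summable_comparison_test'[of "\<lambda>n. (norm (\<xi> n))\<^sup>2 + (norm (\<eta> n))\<^sup>2" 0])
  show "summable (\<lambda>n. (norm (\<xi> n))\<^sup>2 + (norm (\<eta> n))\<^sup>2)"
    using assms unfolding square_summable_def by (rule summable_add)
  show "norm (norm (\<xi> n) * norm (\<eta> n)) \<le> (norm (\<xi> n))\<^sup>2 + (norm (\<eta> n))\<^sup>2" for n
    using sum_squares_bound[of "norm (\<xi> n)" "norm (\<eta> n)"]
      mult_nonneg_nonneg[OF norm_ge_zero[of "\<xi> n"] norm_ge_zero[of "\<eta> n"]]
    unfolding norm_mult real_norm_def abs_norm_cancel by linarith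
qed

text \<open>In a defining functional, \<open>A\<close> moves to the other side of the inner product,
  and \<open>adj A\<close> maps square summable sequences to such sequences.\<close>

lemma continuous_map_compose_left:
  assumes "A \<in> bounded_ops"
  shows "continuous_map ultraweak ultraweak (\<lambda>T. A o\<^sub>L T)"
proof (rule continuous_map_into_ultraweak)
  fix \<xi> \<eta> :: "nat \<Rightarrow> 'a" assume "square_summable \<xi>" "square_summable \<eta>"
  then have "continuous_map ultraweak euclidean
      (\<lambda>T. \<Sum>n. cinner (blinfun_apply T (\<xi> n)) (blinfun_apply (adj A) (\<eta> n)))"
    by (intro continuous_map_ultraweak_functional square_summable_blinfun)
  then show "continuous_map ultraweak euclidean
      (\<lambda>T. \<Sum>n. cinner (blinfun_apply (A o\<^sub>L T) (\<xi> n)) (\<eta> n))"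
    by (simp add: adj_works(2)[OF assms])
qed

section \<open>Ultraweak compactness of operator balls\<close>

definition op_ball :: "real \<Rightarrow> ('h::complex_hilbert_space \<Rightarrow>\<^sub>L 'h) set" where
  "op_ball r = {T \<in> bounded_ops. norm T \<le> r}"

text \<open>Forms are uncurried so that they are points of a product space indexed by pairs of
  vectors, with pointwise convergence as its topology.\<close>

definition bounded_forms :: "real \<Rightarrow> ('h::complex_hilbert_space \<times> 'h \<Rightarrow> complex) set" where
  "bounded_forms r = {B.
    (\<forall>x y z. B (x + y, z) = B (x, z) + B (y, z)) \<and> (\<forall>c x z. B (c *\<^sub>C x, z) = c * B (x, z)) \<and>
    (\<forall>x y z. B (z, x + y) = B (z, x) + B (z, y)) \<and> (\<forall>c x z. B (z, c *\<^sub>C x) = cnj c * B (z, x)) \<and>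
    (\<forall>x y. cmod (B (x, y)) \<le> r * norm x * norm y)}"

text \<open>The bound confines each coordinate to a disc, so Tychonoff applies to the product of
  discs. Every defining condition involves finitely many coordinates and is closed.\<close>

lemma compact_bounded_forms:
  "compact (bounded_forms r :: ('h::complex_hilbert_space \<times> 'h \<Rightarrow> complex) set)"
proof -
  let ?P = "PiE UNIV (\<lambda>(x, y). cball 0 (r * norm x * norm y)) ::
    ('h \<times> 'h \<Rightarrow> complex) set"
  have "compactin (product_topology (\<lambda>_. euclidean) UNIV) ?P"
    unfolding compactin_PiE by auto
  then have "compact ?P" by (simp add: euclidean_product_topology)
  moreover have "closed (bounded_forms r :: ('h \<times> 'h \<Rightarrow> complex) set)"
    unfolding bounded_forms_def
    by (intro closed_Collect_conj closed_Collect_all closed_Collect_eq closed_Collect_le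
        continuous_intros continuous_on_product_coordinates)
  ultimately have "compact (?P \<inter> bounded_forms r)" by (rule compact_Int_closed)
  moreover have "?P \<inter> bounded_forms r = bounded_forms r"
    by (auto simp: bounded_forms_def PiE_def)
  ultimately show ?thesis by simp
qed

text \<open>The common bound \<open>r\<close> makes the series converge uniformly over all forms, so
  pointwise convergence controls the whole series and not only its finite partial sums.\<close>

lemma continuous_on_bounded_forms_suminf:
  fixes \<xi> \<eta> :: "nat \<Rightarrow> 'h::complex_hilbert_space"
  assumes "square_summable \<xi>" "square_summable \<eta>"
  shows "continuous_on (bounded_forms r) (\<lambda>B. \<Sum>n. B (\<xi> n, \<eta> n))"
proof (rule uniform_limit_theorem)
  show "uniform_limit (bounded_forms r) (\<lambda>n B. \<Sum>i<n. B (\<xi> i, \<eta> i))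
      (\<lambda>B. \<Sum>i. B (\<xi> i, \<eta> i)) sequentially"
  proof (rule Weierstrass_m_test)
    show "summable (\<lambda>n. r * (norm (\<xi> n) * norm (\<eta> n)))"
      by (intro summable_mult summable_norm_mult assms)
    show "B \<in> bounded_forms r \<Longrightarrow> norm (B (\<xi> n, \<eta> n)) \<le> r * (norm (\<xi> n) * norm (\<eta> n))" for n B
      by (simp add: bounded_forms_def mult.assoc)
  qed
  show "\<forall>\<^sub>F n in sequentially. continuous_on (bounded_forms r) (\<lambda>B. \<Sum>i<n. B (\<xi> i, \<eta> i))"
    by (intro always_eventually allI continuous_on_sum
        continuous_on_subset[OF continuous_on_product_coordinates]) auto
qed simp

text \<open>\<open>riesz_operator\<close> places the operator in the second slot; swapping the
  arguments and conjugating moves it to the first.\<close>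

lemma bounded_form_operator:
  assumes "B \<in> bounded_forms r" "0 \<le> r"
  obtains T where "T \<in> op_ball r" "\<And>x y. B (x, y) = cinner (blinfun_apply T x) y"
proof -
  have bound: "cmod (cnj (B (y, x))) \<le> r * norm x * norm y" for x y
  proof -
    have "cmod (B (y, x)) \<le> r * norm y * norm x"
      using assms(1) unfolding bounded_forms_def by blast
    then show ?thesis by (simp add: mult_ac)
  qed
  obtain S where S_ball: "S \<in> bounded_ops" "norm S \<le> r"
    and S: "\<And>x y. cnj (B (y, x)) = cinner x (blinfun_apply S y)"
    by (rule riesz_operator[of "\<lambda>x y. cnj (B (y, x))" r])
      (use assms bound in \<open>auto simp: bounded_forms_def\<close>)
  show ?thesis
  proof (rule that)
    show "S \<in> op_ball r" using S_ball by (simp add: op_ball_def)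
    show "B (x, y) = cinner (blinfun_apply S x) y" for x y
      using S[of x y] cinner_commute[of y "blinfun_apply S x"] by simp
  qed
qed

text \<open>By Riesz the ball is the image of the bounded sesquilinear forms, which are compact for pointwise
  convergence by Tychonoff's theorem.\<close>

theorem compactin_op_ball:
  assumes "0 \<le> r"
  shows "compactin ultraweak (op_ball r :: ('h::complex_hilbert_space \<Rightarrow>\<^sub>L 'h) set)"
proof -
  have "\<exists>T. T \<in> op_ball r \<and> (\<forall>x y. B (x, y) = cinner (blinfun_apply T x) y)"
    if "B \<in> bounded_forms r" for B :: "'h \<times> 'h \<Rightarrow> complex"
    using bounded_form_operator[OF that assms] by metis
  then obtain G :: "('h \<times> 'h \<Rightarrow> complex) \<Rightarrow> 'h \<Rightarrow>\<^sub>L 'h" where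
    G: "\<And>B. B \<in> bounded_forms r \<Longrightarrow> G B \<in> op_ball r"
    and G_cinner: "\<And>B x y. B \<in> bounded_forms r \<Longrightarrow> B (x, y) = cinner (blinfun_apply (G B) x) y"
    by metis
  have "continuous_map (top_of_set (bounded_forms r)) ultraweak G"
  proof (rule continuous_map_into_ultraweak)
    fix \<xi> \<eta> :: "nat \<Rightarrow> 'h" assume "square_summable \<xi>" "square_summable \<eta>"
    then have "continuous_on (bounded_forms r) (\<lambda>B. \<Sum>n. B (\<xi> n, \<eta> n))"
      by (rule continuous_on_bounded_forms_suminf)
    also have "?this \<longleftrightarrow>
        continuous_on (bounded_forms r) (\<lambda>B. \<Sum>n. cinner (blinfun_apply (G B) (\<xi> n)) (\<eta> n))"
      by (intro continuous_on_cong refl suminf_cong G_cinner)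
    finally show "continuous_map (top_of_set (bounded_forms r)) euclidean
        (\<lambda>B. \<Sum>n. cinner (blinfun_apply (G B) (\<xi> n)) (\<eta> n))"
      by simp
  qed
  moreover have "compactin (top_of_set (bounded_forms r)) (bounded_forms r :: ('h \<times> 'h \<Rightarrow> complex) set)"
    using compact_bounded_forms by (simp add: compactin_subtopology)
  ultimately have "compactin ultraweak (G ` bounded_forms r)"
    by (intro image_compactin)
  also have "G ` bounded_forms r = op_ball r"
  proof (intro equalityI subsetI)
    fix T :: "'h \<Rightarrow>\<^sub>L 'h" assume T: "T \<in> op_ball r"
    \<comment> \<open>The form of \<open>T\<close> is sent back to \<open>T\<close>, since matrix
      coefficients determine an operator; hence \<open>G\<close> is onto the ball.\<close>
    define B where "B = (\<lambda>(x, y). cinner (blinfun_apply T x) y)"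
    have B_app: "B (x, y) = cinner (blinfun_apply T x) y" for x y
      by (simp add: B_def)
    have "norm T * norm x * norm y \<le> r * norm x * norm y" for x y :: 'h
      using T by (intro mult_right_mono) (auto simp: op_ball_def)
    then have "B \<in> bounded_forms r"
      using T order_trans[OF cinner_blinfun_bound[of T]] unfolding bounded_forms_def B_def op_ball_def
      by (auto simp: blinfun.add_right cinner_add_left cinner_add_right bounded_opsD
          cinner_scaleC_left cinner_scaleC_right)
    moreover from this have "T = G B"
      by (intro blinfun_sesquilinear_eqI) (simp only: G_cinner flip: B_app)
    ultimately show "T \<in> G ` bounded_forms r" by blast
  qed (use G in auto)
  finally show ?thesis .
qed

section \<open>Von Neumann algebras\<close>

lemma bounded_ops_id: "id_blinfun \<in> bounded_ops"
  by (simp add: bounded_ops_def)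

lemma compose_scaleC_left: "(c *\<^sub>C A) o\<^sub>L B = c *\<^sub>C (A o\<^sub>L B)"
  by (rule blinfun_eqI) simp

lemma compose_scaleC_right: "A \<in> bounded_ops \<Longrightarrow> A o\<^sub>L (c *\<^sub>C B) = c *\<^sub>C (A o\<^sub>L B)"
  by (rule blinfun_eqI) (simp add: bounded_opsD)

lemma compose_add_left: "(A + B) o\<^sub>L C = (A o\<^sub>L C) + (B o\<^sub>L C)"
  by (rule bounded_bilinear.add_left[OF bounded_bilinear_blinfun_compose])

lemma compose_add_right: "A o\<^sub>L (B + C) = (A o\<^sub>L B) + (A o\<^sub>L C)"
  by (rule bounded_bilinear.add_right[OF bounded_bilinear_blinfun_compose])

lemma compose_assoc: "(A o\<^sub>L B) o\<^sub>L C = A o\<^sub>L (B o\<^sub>L C)"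
  by (rule blinfun_eqI) simp

lemma compose_id [simp]: "id_blinfun o\<^sub>L A = A" "A o\<^sub>L id_blinfun = A"
  by (rule blinfun_eqI, simp)+

lemma blinfun_eq_iff: "S = T \<longleftrightarrow> (\<forall>x. blinfun_apply S x = blinfun_apply T x)"
  by (auto intro: blinfun_eqI)

lemma commutant_iff:
  "T \<in> commutant S \<longleftrightarrow> T \<in> bounded_ops \<and>
    (\<forall>A\<in>S. \<forall>x. blinfun_apply T (blinfun_apply A x) = blinfun_apply A (blinfun_apply T x))"
  by (auto simp: commutant_def blinfun_eq_iff)

context
  fixes M :: "('h::complex_hilbert_space \<Rightarrow>\<^sub>L 'h) set"
  assumes vna: "von_neumann_algebra M"
begin

lemma vna_bounded_ops: "x \<in> M \<Longrightarrow> x \<in> bounded_ops"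
  using vna by (auto simp: von_neumann_algebra_def)

lemma vna_adj: "x \<in> M \<Longrightarrow> adj x \<in> M"
  using vna by (auto simp: von_neumann_algebra_def)

text \<open>The double commutant condition as a pointwise membership test, from which sums,
  multiples, products and closedness are obtained.\<close>

lemma vna_iff: "x \<in> M \<longleftrightarrow> x \<in> bounded_ops \<and>
    (\<forall>A \<in> commutant M. \<forall>v. blinfun_apply x (blinfun_apply A v) = blinfun_apply A (blinfun_apply x v))"
  using vna commutant_iff[of x "commutant M"] by (simp add: von_neumann_algebra_def)

lemma vna_add: "x \<in> M \<Longrightarrow> y \<in> M \<Longrightarrow> x + y \<in> M"
  unfolding vna_iff by (simp add: bounded_ops_def blinfun.add_left blinfun.add_right scaleC_add_right)

lemma vna_scaleC: "x \<in> M \<Longrightarrow> c *\<^sub>C x \<in> M"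
  unfolding vna_iff
  by (auto simp: bounded_ops_def commutant_def scaleC_scaleC mult.commute)

lemma vna_diff: "x \<in> M \<Longrightarrow> y \<in> M \<Longrightarrow> x - y \<in> M"
  using vna_add[of x "(- 1) *\<^sub>C y"] vna_scaleC[of y "- 1"] by simp

lemma vna_compose: "x \<in> M \<Longrightarrow> y \<in> M \<Longrightarrow> x o\<^sub>L y \<in> M"
  unfolding vna_iff by (simp add: bounded_ops_def)

lemma vna_id: "id_blinfun \<in> M"
  unfolding vna_iff by (simp add: bounded_ops_def)

text \<open>Complex linearity and commutation with the commutant are families of equations between
  matrix coefficients, which are ultraweakly continuous.\<close>

lemma closedin_vna: "closedin ultraweak M"
proof -
  have all: "closedin X {x \<in> topspace X. \<forall>i. P i x}"
    if "\<And>i. closedin X {x \<in> topspace X. P i x}" for X :: "'a topology" and P :: "'i \<Rightarrow> 'a \<Rightarrow> bool"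
  proof -
    have "{x \<in> topspace X. \<forall>i. P i x} = (\<Inter>i. {x \<in> topspace X. P i x})" by auto
    with that show ?thesis by auto
  qed
  let ?c = "\<lambda>T x y. cinner (blinfun_apply T x) y"
  \<comment> \<open>One shape for both families: \<open>k = c\<close> for complex linearity and
    \<open>k = 1\<close> for commutation.\<close>
  have eq: "closedin ultraweak {T \<in> topspace ultraweak. ?c T x y = k * ?c T x' y'}"
    for x y x' y' :: 'h and k
  proof (rule closedin_continuous_maps_eq[OF Hausdorff_space_euclidean continuous_map_ultraweak_cinner])
    have "continuous_map euclidean euclidean (\<lambda>z. k * z)"
      by (simp add: continuous_on_mult_left)
    from continuous_map_compose[OF continuous_map_ultraweak_cinner this]
    show "continuous_map ultraweak euclidean (\<lambda>T. k * ?c T x' y')"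
      by (simp add: o_def)
  qed
  have op: "x \<in> bounded_ops \<longleftrightarrow> (\<forall>c v w. ?c x (c *\<^sub>C v) w = c * ?c x v w)" for x :: "'h \<Rightarrow>\<^sub>L 'h"
  proof
    assume "\<forall>c v w. ?c x (c *\<^sub>C v) w = c * ?c x v w"
    then have "blinfun_apply x (c *\<^sub>C v) = c *\<^sub>C blinfun_apply x v" for c v
      by (intro cinner_right_cong) (simp only: cinner_scaleC_left)
    then show "x \<in> bounded_ops" by (simp add: bounded_ops_def)
  qed (simp add: bounded_opsD cinner_scaleC_left)
  have comm: "(\<forall>v. blinfun_apply x (blinfun_apply A v) = blinfun_apply A (blinfun_apply x v)) \<longleftrightarrow>
      (\<forall>v w. ?c x (blinfun_apply A v) w = 1 * ?c x v (blinfun_apply (adj A) w))"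
    if "A \<in> commutant M" for A x
  proof -
    have A: "A \<in> bounded_ops" using that by (simp add: commutant_def)
    show ?thesis
      unfolding adj_works(2)[OF A, symmetric] mult_1 by (metis cinner_right_cong)
  qed
  have "x \<in> M \<longleftrightarrow> (\<forall>c v w. ?c x (c *\<^sub>C v) w = c * ?c x v w) \<and>
      (\<forall>A v w. A \<in> commutant M \<longrightarrow> ?c x (blinfun_apply A v) w = 1 * ?c x v (blinfun_apply (adj A) w))" for x
    unfolding vna_iff op Ball_def using comm by presburger
  then have "M = {T \<in> topspace ultraweak. \<forall>c v w. ?c T (c *\<^sub>C v) w = c * ?c T v w} \<inter>
      {T \<in> topspace ultraweak. \<forall>A v w. A \<in> commutant M \<longrightarrow>
        ?c T (blinfun_apply A v) w = 1 * ?c T v (blinfun_apply (adj A) w)}"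
    by (intro set_eqI) simp
  also have "closedin ultraweak \<dots>"
  proof (intro closedin_Int all)
    fix A v w
    show "closedin ultraweak {T \<in> topspace ultraweak. A \<in> commutant M \<longrightarrow>
        ?c T (blinfun_apply A v) w = 1 * ?c T v (blinfun_apply (adj A) w)}"
      using eq[of "blinfun_apply A v" w 1] closedin_topspace[of ultraweak]
      by (cases "A \<in> commutant M") simp_all
  qed (rule eq)
  finally show ?thesis .
qed

end

section \<open>Operators commuting with all unitaries\<close>

lemma inj_add_imaginary:
  assumes "norm a < 1"
    and "blinfun_apply a x + \<i> *\<^sub>C x = blinfun_apply a y + \<i> *\<^sub>C (y :: 'h::complex_hilbert_space)"
  shows "x = y"
proof -
  \<comment> \<open>The difference would be an eigenvector for an eigenvalue of modulus 1, which the
    norm bound on \<open>a\<close> forces to be 0.\<close>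
  have "blinfun_apply a (x - y) = - (\<i> *\<^sub>C (x - y))"
    using assms(2) by (simp add: blinfun.diff_right scaleC_diff_right algebra_simps)
  then have "norm (x - y) = norm (blinfun_apply a (x - y))" by (simp add: norm_scaleC)
  also have "\<dots> \<le> norm a * norm (x - y)" by (rule norm_blinfun)
  finally have "(1 - norm a) * norm (x - y) \<le> 0" by (simp add: algebra_simps)
  then show ?thesis using assms(1) by (simp add: mult_le_0_iff)
qed

text \<open>The equation \<open>(a + \<i>) R = 1\<close> is rewritten as
  \<open>R = - \<i> (1 - a R)\<close>, a fixed point problem with contraction constant
  \<open>norm a\<close>. Since \<open>a + \<i>\<close> is injective, the right inverse is also a
  left inverse.\<close>

lemma resolvent_imaginary:
  fixes a :: "'h::complex_hilbert_space \<Rightarrow>\<^sub>L 'h"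
  assumes "norm a < 1"
  obtains R where "\<And>v. blinfun_apply a (blinfun_apply R v) + \<i> *\<^sub>C blinfun_apply R v = v"
    "\<And>v. blinfun_apply R (blinfun_apply a v + \<i> *\<^sub>C v) = v"
proof -
  define f where "f R = (- \<i>) *\<^sub>C (id_blinfun - (a o\<^sub>L R))" for R
  have "\<exists>!R. f R = R"
  proof (rule banach_fix_type)
    show "\<forall>R S. dist (f R) (f S) \<le> norm a * dist R S"
    proof (intro allI)
      fix R S :: "'h \<Rightarrow>\<^sub>L 'h"
      have "f R - f S = \<i> *\<^sub>C (a o\<^sub>L (R - S))"
        by (rule blinfun_eqI)
          (simp add: f_def blinfun.diff_left blinfun.diff_right scaleC_diff_right algebra_simps)
      then show "dist (f R) (f S) \<le> norm a * dist R S"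
        using norm_blinfun_compose[of a "R - S"] by (simp add: dist_norm norm_scaleC)
    qed
  qed (use assms in auto)
  then obtain R where R: "f R = R" by blast
  have right: "blinfun_apply a (blinfun_apply R v) + \<i> *\<^sub>C blinfun_apply R v = v" for v
  proof -
    have "\<i> *\<^sub>C blinfun_apply R v = \<i> *\<^sub>C blinfun_apply (f R) v" by (simp add: R)
    also have "\<dots> = v - blinfun_apply a (blinfun_apply R v)"
      by (simp add: f_def scaleC_scaleC blinfun.diff_left blinfun.minus_left)
    finally show ?thesis by simp
  qed
  have "blinfun_apply R (blinfun_apply a v + \<i> *\<^sub>C v) = v" for v
    by (rule inj_add_imaginary[OF assms]) (rule right)
  with right show ?thesis using that by blast
qed

text \<open>The Cayley transform \<open>u = (a - \<i>)(a + \<i>)\<^sup>-\<^sup>1 = 1 - 2 \<i> (a + \<i>)\<^sup>-\<^sup>1\<close> is a unitary of \<open>M\<close>, and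
  whatever commutes with \<open>u\<close> commutes with \<open>a\<close>.\<close>

lemma commute_selfadjoint_if_commute_unitaries:
  assumes vna: "von_neumann_algebra M" and a: "a \<in> M" "adj a = a" "norm a < 1"
    and y: "y \<in> bounded_ops"
    and unitaries: "\<And>u. u \<in> M \<Longrightarrow> unitary_op u \<Longrightarrow> y o\<^sub>L u = u o\<^sub>L y"
  shows "y o\<^sub>L a = a o\<^sub>L y"
proof -
  obtain R where R_right: "\<And>v. blinfun_apply a (blinfun_apply R v) + \<i> *\<^sub>C blinfun_apply R v = v"
    and R_left: "\<And>v. blinfun_apply R (blinfun_apply a v + \<i> *\<^sub>C v) = v"
    using resolvent_imaginary[OF a(3)] by blast
  note inj = inj_add_imaginary[OF a(3)]
  have a_op: "a \<in> bounded_ops" by (rule vna_bounded_ops[OF vna a(1)])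
  \<comment> \<open>Complex linearity of \<open>R\<close>, and below its membership in
    \<open>M\<close>, are checked after applying the injective map \<open>a + \<i>\<close>.\<close>
  have R_op: "R \<in> bounded_ops"
    unfolding bounded_ops_def
  proof (intro CollectI allI, rule inj)
    fix c v
    have "blinfun_apply a (c *\<^sub>C blinfun_apply R v) + \<i> *\<^sub>C c *\<^sub>C blinfun_apply R v =
        c *\<^sub>C (blinfun_apply a (blinfun_apply R v) + \<i> *\<^sub>C blinfun_apply R v)"
      by (simp add: bounded_opsD[OF a_op] scaleC_add_right scaleC_scaleC mult.commute)
    then show "blinfun_apply a (blinfun_apply R (c *\<^sub>C v)) + \<i> *\<^sub>C blinfun_apply R (c *\<^sub>C v) =
        blinfun_apply a (c *\<^sub>C blinfun_apply R v) + \<i> *\<^sub>C c *\<^sub>C blinfun_apply R v"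
      by (simp only: R_right)
  qed
  have R_M: "R \<in> M"
    unfolding vna_iff[OF vna]
  proof (intro conjI R_op ballI allI, rule inj)
    fix T v assume T: "T \<in> commutant M"
    have "blinfun_apply a (blinfun_apply T (blinfun_apply R v)) + \<i> *\<^sub>C blinfun_apply T (blinfun_apply R v) =
        blinfun_apply T (blinfun_apply a (blinfun_apply R v) + \<i> *\<^sub>C blinfun_apply R v)"
      using T a(1) by (simp add: commutant_iff blinfun.add_right bounded_opsD)
    then show "blinfun_apply a (blinfun_apply R (blinfun_apply T v)) + \<i> *\<^sub>C blinfun_apply R (blinfun_apply T v) =
        blinfun_apply a (blinfun_apply T (blinfun_apply R v)) + \<i> *\<^sub>C blinfun_apply T (blinfun_apply R v)"
      by (simp only: R_right)
  qed
  \<comment> \<open>As \<open>a\<close> is self-adjoint, \<open>adj R\<close> inverts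
    \<open>a - \<i>\<close>.\<close>
  have R'_left: "blinfun_apply (adj R) (blinfun_apply a x - \<i> *\<^sub>C x) = x" for x
  proof (rule cinner_left_cong)
    fix w
    have "cinner w (blinfun_apply (adj R) (blinfun_apply a x - \<i> *\<^sub>C x)) =
        cinner (blinfun_apply a (blinfun_apply R w) + \<i> *\<^sub>C blinfun_apply R w) x"
      using adj_works(2)[OF a_op] adj_works(2)[OF R_op, symmetric]
      by (simp add: a(2) cinner_diff_right cinner_add_left cinner_scaleC_left cinner_scaleC_right)
    then show "cinner w (blinfun_apply (adj R) (blinfun_apply a x - \<i> *\<^sub>C x)) = cinner w x"
      by (simp only: R_right)
  qed
  have R'_right: "blinfun_apply a (blinfun_apply (adj R) x) - \<i> *\<^sub>C blinfun_apply (adj R) x = x" for x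
  proof (rule cinner_left_cong)
    fix w
    have "cinner w (blinfun_apply a (blinfun_apply (adj R) x) - \<i> *\<^sub>C blinfun_apply (adj R) x) =
        cinner (blinfun_apply R (blinfun_apply a w + \<i> *\<^sub>C w)) x"
      using adj_works(2)[OF a_op] adj_works(2)[OF R_op]
      by (simp add: a(2) cinner_diff_right cinner_add_left cinner_scaleC_left cinner_scaleC_right)
    then show "cinner w (blinfun_apply a (blinfun_apply (adj R) x) - \<i> *\<^sub>C blinfun_apply (adj R) x) =
        cinner w x"
      by (simp only: R_left)
  qed
  define u where "u = id_blinfun + (- 2 * \<i>) *\<^sub>C R"
  have u_apply: "blinfun_apply u v = v - (2 * \<i>) *\<^sub>C blinfun_apply R v" for v
    by (simp add: u_def blinfun.diff_left)
  have u_M: "u \<in> M"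
    unfolding u_def by (intro vna_add vna_id vna_scaleC vna R_M)
  have adj_u: "adj u = id_blinfun + (2 * \<i>) *\<^sub>C adj R"
    unfolding u_def adj_add[OF bounded_ops_id vna_bounded_ops[OF vna vna_scaleC[OF vna R_M]]]
      adj_scaleC[OF R_op] adj_id by simp
  have adj_u_apply: "blinfun_apply (adj u) v = v + (2 * \<i>) *\<^sub>C blinfun_apply (adj R) v" for v
    by (simp add: adj_u blinfun.add_left)
  have two: "(2 * \<i>) *\<^sub>C w = \<i> *\<^sub>C w + \<i> *\<^sub>C w" for w :: 'a
    by (simp flip: scaleC_add_left)
  \<comment> \<open>In terms of \<open>w\<close>, the operator \<open>u\<close> sends
    \<open>(a + \<i>) w\<close> to \<open>(a - \<i>) w\<close>, and \<open>adj u\<close> sends it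
    back.\<close>
  have "blinfun_apply (adj u) (blinfun_apply u v) = v" for v
  proof -
    define w where "w = blinfun_apply R v"
    have v: "v = blinfun_apply a w + \<i> *\<^sub>C w" by (simp add: w_def R_right)
    have uv: "blinfun_apply u v = blinfun_apply a w - \<i> *\<^sub>C w"
      unfolding u_apply w_def[symmetric] by (simp add: v two)
    show ?thesis unfolding uv adj_u_apply R'_left by (simp add: v two)
  qed
  moreover have "blinfun_apply u (blinfun_apply (adj u) v) = v" for v
  proof -
    define w where "w = blinfun_apply (adj R) v"
    have v: "v = blinfun_apply a w - \<i> *\<^sub>C w" by (simp add: w_def R'_right)
    have uv: "blinfun_apply (adj u) v = blinfun_apply a w + \<i> *\<^sub>C w"
      unfolding adj_u_apply w_def[symmetric] by (simp add: v two)
    show ?thesis unfolding uv u_apply R_left by (simp add: v two)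
  qed
  ultimately have "unitary_op u"
    unfolding unitary_op_def by (auto intro!: blinfun_eqI vna_bounded_ops[OF vna] u_M)
  then have "y o\<^sub>L u = u o\<^sub>L y" by (rule unitaries[OF u_M])
  then have "(2 * \<i>) *\<^sub>C blinfun_apply y (blinfun_apply R v) =
      (2 * \<i>) *\<^sub>C blinfun_apply R (blinfun_apply y v)" for v
    using bounded_opsD[OF y] by (simp add: blinfun_eq_iff u_apply blinfun.diff_right)
  then have "(1 / (2 * \<i>)) *\<^sub>C (2 * \<i>) *\<^sub>C blinfun_apply y (blinfun_apply R v) =
      (1 / (2 * \<i>)) *\<^sub>C (2 * \<i>) *\<^sub>C blinfun_apply R (blinfun_apply y v)" for v
    by presburger
  then have yR: "blinfun_apply y (blinfun_apply R v) = blinfun_apply R (blinfun_apply y v)" for v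
    unfolding scaleC_scaleC by simp
  show ?thesis
  proof (rule blinfun_eqI)
    fix w
    \<comment> \<open>Write \<open>w\<close> as \<open>R (a + \<i>) w\<close> and pull
      \<open>y\<close> through \<open>R\<close>; applying \<open>a + \<i>\<close> then shows that
      \<open>y\<close> commutes with \<open>a + \<i>\<close>.\<close>
    have "blinfun_apply y w = blinfun_apply R (blinfun_apply y (blinfun_apply a w + \<i> *\<^sub>C w))"
      by (metis R_left yR)
    then have "blinfun_apply a (blinfun_apply y w) + \<i> *\<^sub>C blinfun_apply y w =
        blinfun_apply y (blinfun_apply a w + \<i> *\<^sub>C w)"
      using R_right by metis
    then show "blinfun_apply (y o\<^sub>L a) w = blinfun_apply (a o\<^sub>L y) w"
      by (simp add: blinfun.add_right bounded_opsD[OF y])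
  qed
qed

text \<open>Self-adjoint elements reduce to the previous lemma by rescaling, and every element is a
  combination of two self-adjoint ones.\<close>

lemma commutant_if_commute_unitaries:
  assumes vna: "von_neumann_algebra M" and y: "y \<in> bounded_ops"
    and unitaries: "\<And>u. u \<in> M \<Longrightarrow> unitary_op u \<Longrightarrow> y o\<^sub>L u = u o\<^sub>L y"
  shows "y \<in> commutant M"
proof -
  have sa: "y o\<^sub>L a = a o\<^sub>L y" if a: "a \<in> M" "adj a = a" for a
  proof -
    \<comment> \<open>The summand 1 makes the rescaled norm strictly less than 1 and keeps the
      scalar defined for \<open>a = 0\<close>.\<close>
    define c where "c = complex_of_real (inverse (1 + norm a))"
    have pos: "0 < 1 + norm a" by (simp add: add_pos_nonneg)
    have "norm (c *\<^sub>C a) < 1"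
      using pos unfolding norm_scaleC c_def norm_of_real by (simp add: field_simps)
    moreover have "adj (c *\<^sub>C a) = c *\<^sub>C a"
      using a vna_bounded_ops[OF vna] by (simp add: adj_scaleC c_def)
    ultimately have "y o\<^sub>L (c *\<^sub>C a) = (c *\<^sub>C a) o\<^sub>L y"
      using a by (intro commute_selfadjoint_if_commute_unitaries[OF vna _ _ _ y unitaries]
          vna_scaleC[OF vna])
    then have "inverse c *\<^sub>C c *\<^sub>C (y o\<^sub>L a) = inverse c *\<^sub>C c *\<^sub>C (a o\<^sub>L y)"
      by (simp add: compose_scaleC_left compose_scaleC_right y)
    moreover have "c \<noteq> 0" using pos unfolding c_def of_real_eq_0_iff by simp
    ultimately show ?thesis by (simp add: scaleC_scaleC)
  qed
  have "y o\<^sub>L x = x o\<^sub>L y" if x: "x \<in> M" for x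
  proof -
    have op: "x \<in> bounded_ops" "adj x \<in> bounded_ops"
      using vna_bounded_ops[OF vna] x vna_adj[OF vna] by auto
    \<comment> \<open>Twice the real part and minus twice the imaginary part of \<open>x\<close>, so
      \<open>a - \<i> b = 2 x\<close>.\<close>
    define a b where "a = x + adj x" and "b = \<i> *\<^sub>C x + (- \<i>) *\<^sub>C adj x"
    have "a \<in> M" "b \<in> M"
      unfolding a_def b_def using x by (auto intro!: vna_add vna_diff vna_adj vna_scaleC vna)
    moreover have "adj a = a" "adj b = b"
      unfolding a_def b_def using x vna_bounded_ops[OF vna vna_scaleC[OF vna]] vna_adj[OF vna] op
      by (simp_all add: adj_add adj_scaleC adj_adj add.commute del: scaleC_minus_left)
    ultimately have ab: "y o\<^sub>L a = a o\<^sub>L y" "y o\<^sub>L b = b o\<^sub>L y" by (auto intro: sa)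
    have "a + (- \<i>) *\<^sub>C b = 2 *\<^sub>C x"
      using scaleC_add_left[of 1 1 x] by (simp add: a_def b_def scaleC_diff_right scaleC_scaleC)
    then have x_eq: "x = (1/2) *\<^sub>C (a + (- \<i>) *\<^sub>C b)"
      by (simp add: scaleC_scaleC)
    show ?thesis unfolding x_eq
      by (simp add: compose_scaleC_left compose_scaleC_right y compose_add_left compose_add_right ab
          del: scaleC_minus_left)
  qed
  with y show ?thesis by (simp add: commutant_def)
qed

section \<open>Uniqueness of the trace\<close>

text \<open>Without a minimum, the open sets \<open>V z\<close> with \<open>z\<close> in
  \<open>K\<close> would cover \<open>K\<close>. In a finite subcover, the centre with the least
  value of \<open>f\<close> would be left uncovered.\<close>

lemma compactin_attains_min:
  fixes f :: "'a \<Rightarrow> real"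
  assumes K: "compactin X K" "K \<noteq> {}"
    and lsc: "\<And>s. closedin X {x \<in> topspace X. f x \<le> s}"
  obtains m where "m \<in> K" "\<And>x. x \<in> K \<Longrightarrow> f m \<le> f x"
proof -
  have "\<exists>m\<in>K. \<forall>x\<in>K. f m \<le> f x"
  proof (rule ccontr)
    assume no_min: "\<not> ?thesis"
    define V where "V z = {x \<in> topspace X. f z < f x}" for z
    have "openin X (V z)" for z
    proof -
      have "V z = topspace X - {x \<in> topspace X. f x \<le> f z}" by (auto simp: V_def)
      then show ?thesis using lsc[of "f z"] by (simp add: openin_diff)
    qed
    moreover have "K \<subseteq> \<Union> (V ` K)"
      using no_min compactin_subset_topspace[OF K(1)] by (fastforce simp: V_def not_le)
    ultimately obtain \<F> where \<F>: "finite \<F>" "\<F> \<subseteq> V ` K" "K \<subseteq> \<Union> \<F>"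
      using compactinD[OF K(1), of "V ` K"] by auto
    obtain F where F: "finite F" "F \<subseteq> K" "\<F> = V ` F"
      using finite_subset_image[OF \<F>(1,2)] by blast
    have "F \<noteq> {}" using F \<F> K(2) by auto
    then obtain z where z: "z \<in> F" "\<And>y. y \<in> F \<Longrightarrow> f z \<le> f y"
      using ex_is_arg_min_if_finite[OF F(1), of f] by (auto simp: is_arg_min_linorder)
    then have "z \<in> \<Union> (V ` F)" using F \<F> by auto
    then show False using z by (force simp: V_def)
  qed
  then show ?thesis using that by blast
qed

text \<open>Both \<open>u\<close> and \<open>adj u\<close> are isometries. The bounds ensure that
  unitary conjugation does not increase the norm.\<close>

lemma norm_unitary_le:
  assumes "unitary_op u"
  shows "norm u \<le> 1" "norm (adj u) \<le> 1"
proof -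
  have u: "u \<in> bounded_ops" "adj u o\<^sub>L u = id_blinfun" "u o\<^sub>L adj u = id_blinfun"
    using assms by (auto simp: unitary_op_def)
  have iso: "norm (blinfun_apply v x) = norm x"
    if v: "v \<in> bounded_ops" "adj v o\<^sub>L v = id_blinfun" for v :: "'a \<Rightarrow>\<^sub>L 'a" and x
  proof -
    have "blinfun_apply (adj v) (blinfun_apply v x) = x"
      using v(2) by (simp add: blinfun_eq_iff)
    then have "cinner (blinfun_apply v x) (blinfun_apply v x) = cinner x x"
      by (simp add: adj_works(2)[OF v(1)])
    then have "(norm (blinfun_apply v x))\<^sup>2 = (norm x)\<^sup>2"
      unfolding cinner_self of_real_eq_iff .
    then show ?thesis by simp
  qed
  show "norm u \<le> 1"
    by (rule norm_blinfun_bound) (simp_all add: iso[OF u(1,2)])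
  have "norm (blinfun_apply (adj u) x) = norm x" for x
    using iso[OF adj_works(1)[OF u(1)]] u by (simp add: adj_adj)
  then show "norm (adj u) \<le> 1"
    by (intro norm_blinfun_bound) simp_all
qed

section \<open>Normal functionals under composition\<close>

lemma predual_compose_left:
  assumes vna: "von_neumann_algebra M" and \<rho>: "\<rho> \<in> predual M" and A: "A \<in> M"
  shows "(\<lambda>x. \<rho> (A o\<^sub>L x)) \<in> predual M"
proof -
  have op: "A \<in> bounded_ops" using A by (rule vna_bounded_ops[OF vna])
  have "continuous_map (subtopology ultraweak M) (subtopology ultraweak M) (\<lambda>x. A o\<^sub>L x)"
    using continuous_map_compose_left[OF op] A
    by (auto simp: continuous_map_in_subtopology vna_compose[OF vna] continuous_map_from_subtopology)
  from continuous_map_compose[OF this, of euclidean \<rho>] \<rho>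
  have "continuous_map (subtopology ultraweak M) euclidean (\<lambda>x. \<rho> (A o\<^sub>L x))"
    by (simp add: predual_def o_def)
  moreover have "linear_functional_on M (\<lambda>x. \<rho> (A o\<^sub>L x))"
    using \<rho> A by (auto simp: predual_def linear_functional_on_def compose_add_right
        compose_scaleC_right op vna_compose[OF vna])
  ultimately show ?thesis by (simp add: predual_def)
qed

lemma predual_endomorphism:
  assumes \<rho>: "\<rho> \<in> predual M" and \<theta>: "normal_unital_star_endomorphism M \<theta>"
  shows "(\<lambda>x. \<rho> (\<theta> x)) \<in> predual M"
proof -
  have "continuous_map (subtopology ultraweak M) (subtopology ultraweak M) \<theta>"
    using \<theta> by (simp add: normal_unital_star_endomorphism_def)
  from continuous_map_compose[OF this] \<rho> \<theta> show ?thesis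
    by (auto simp: predual_def o_def linear_functional_on_def normal_unital_star_endomorphism_def)
qed

section \<open>The Hilbert norm of the trace and its minimizers\<close>

context
  fixes M :: "('h::complex_hilbert_space \<Rightarrow>\<^sub>L 'h) set"
    and \<tau> :: "('h \<Rightarrow>\<^sub>L 'h) \<Rightarrow> complex"
  assumes vna: "von_neumann_algebra M" and tr: "trace_on M \<tau>"
begin

private lemmas closure = vna_add[OF vna] vna_scaleC[OF vna] vna_compose[OF vna] vna_adj[OF vna]
  vna_diff[OF vna] vna_id[OF vna]

private lemma linear_add: "linear_functional_on M \<rho> \<Longrightarrow> x \<in> M \<Longrightarrow> y \<in> M \<Longrightarrow> \<rho> (x + y) = \<rho> x + \<rho> y"
  by (simp add: linear_functional_on_def)

private lemma linear_scaleC: "linear_functional_on M \<rho> \<Longrightarrow> x \<in> M \<Longrightarrow> \<rho> (c *\<^sub>C x) = c * \<rho> x"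
  by (simp add: linear_functional_on_def)

private lemma trace_linear: "linear_functional_on M \<tau>"
  using tr by (simp add: trace_on_def predual_def)

text \<open>The squared norm of the GNS space of \<tau>, as a real number so that it can be
  minimized.\<close>

definition L2_square :: "('h \<Rightarrow>\<^sub>L 'h) \<Rightarrow> real" where
  "L2_square x = Re (\<tau> (adj x o\<^sub>L x))"

text \<open>The scalar is kept general: \<open>c = \<i>\<close> yields the symmetry of the real
  part, and \<open>c = - 1\<close> and \<open>c = 1\<close> yield differences and sums.\<close>

lemma trace_square_expand:
  assumes x: "x \<in> M" and y: "y \<in> M"
  shows "\<tau> (adj (x + c *\<^sub>C y) o\<^sub>L (x + c *\<^sub>C y)) = \<tau> (adj x o\<^sub>L x) + c * \<tau> (adj x o\<^sub>L y) +
    cnj c * \<tau> (adj y o\<^sub>L x) + cnj c * c * \<tau> (adj y o\<^sub>L y)"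
proof -
  note op = vna_bounded_ops[OF vna]
  have adj: "adj (x + c *\<^sub>C y) = adj x + cnj c *\<^sub>C adj y"
    using x y by (simp add: adj_add adj_scaleC op closure)
  have "adj (x + c *\<^sub>C y) o\<^sub>L (x + c *\<^sub>C y) =
      ((adj x o\<^sub>L x) + c *\<^sub>C (adj x o\<^sub>L y)) +
      (cnj c *\<^sub>C (adj y o\<^sub>L x) + (cnj c * c) *\<^sub>C (adj y o\<^sub>L y))"
    unfolding adj using x y
    by (simp add: compose_add_left compose_add_right compose_scaleC_left compose_scaleC_right
        op closure scaleC_scaleC scaleC_add_right algebra_simps)
  then show ?thesis
    using x y by (simp add: linear_add[OF trace_linear] linear_scaleC[OF trace_linear] closure)
qed

lemma trace_square_nonneg: "x \<in> M \<Longrightarrow> Im (\<tau> (adj x o\<^sub>L x)) = 0" "x \<in> M \<Longrightarrow> 0 \<le> L2_square x"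
  using tr by (auto simp: trace_on_def L2_square_def)

lemma L2_square_eq_0: "x \<in> M \<Longrightarrow> L2_square x = 0 \<Longrightarrow> x = 0"
  using tr by (auto simp: trace_on_def L2_square_def complex_eq_iff)

text \<open>Polarization: the trace of the square of \<open>x + \<i> *\<^sub>C y\<close> is real,
  and the cross terms of its imaginary part are the difference of the two sides.\<close>

lemma Re_trace_commute:
  assumes "x \<in> M" "y \<in> M"
  shows "Re (\<tau> (adj x o\<^sub>L y)) = Re (\<tau> (adj y o\<^sub>L x))"
proof -
  have "0 = Im (\<tau> (adj (x + \<i> *\<^sub>C y) o\<^sub>L (x + \<i> *\<^sub>C y)))"
    by (rule trace_square_nonneg(1)[symmetric]) (intro closure assms)
  then show ?thesis
    using trace_square_nonneg(1) assms by (simp add: trace_square_expand)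
qed

lemma L2_square_diff:
  assumes "x \<in> M" "y \<in> M"
  shows "L2_square (x - y) = L2_square x + L2_square y - 2 * Re (\<tau> (adj y o\<^sub>L x))"
  using trace_square_expand[OF assms, of "- 1"] Re_trace_commute[OF assms]
  by (simp add: L2_square_def)

text \<open>The parallelogram law in the form that makes minimizers on convex sets unique.\<close>

lemma L2_square_midpoint:
  assumes "x \<in> M" "y \<in> M"
  shows "L2_square ((1/2) *\<^sub>C (x + y)) = (L2_square x + L2_square y) / 2 - L2_square (x - y) / 4"
proof -
  have op: "x + y \<in> bounded_ops" "adj (x + y) \<in> bounded_ops"
    by (auto intro!: vna_bounded_ops[OF vna] closure assms)
  have "\<tau> (adj ((1/2) *\<^sub>C (x + y)) o\<^sub>L ((1/2) *\<^sub>C (x + y))) = 1/4 * \<tau> (adj (x + y) o\<^sub>L (x + y))"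
    using assms by (simp add: adj_scaleC compose_scaleC_left compose_scaleC_right op scaleC_scaleC
        linear_scaleC[OF trace_linear] closure)
  then have "L2_square ((1/2) *\<^sub>C (x + y)) = L2_square (x + y) / 4"
    by (auto simp: L2_square_def complex_eq_iff)
  moreover have "L2_square (x + y) = L2_square x + L2_square y + 2 * Re (\<tau> (adj y o\<^sub>L x))"
    using trace_square_expand[OF assms, of 1] Re_trace_commute[OF assms] by (simp add: L2_square_def)
  ultimately show ?thesis
    using L2_square_diff[OF assms] by (simp add: field_simps)
qed

text \<open>\<open>\<tau>(x\<^sup>* x) \<le> s\<close> holds iff \<open>2 Re \<tau>(z\<^sup>* x) \<le> s + \<tau>(z\<^sup>* z)\<close> for all \<open>z\<close>, and each of these conditions
  is closed.\<close>

lemma closedin_L2_ball: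
  "closedin (subtopology ultraweak M) {x \<in> topspace (subtopology ultraweak M). L2_square x \<le> s}"
proof -
  let ?X = "subtopology ultraweak M"
  let ?C = "\<lambda>z. {x \<in> topspace ?X. Re (\<tau> (adj z o\<^sub>L x)) \<in> {..(s + L2_square z) / 2}}"
  have "closedin ?X (?C z)" if "z \<in> M" for z
  proof (rule closedin_continuous_map_preimage)
    have "continuous_map ?X euclidean (\<lambda>x. \<tau> (adj z o\<^sub>L x))"
      using predual_compose_left[OF vna, of \<tau> "adj z"] tr that
      by (auto simp: trace_on_def predual_def closure)
    from continuous_map_compose[OF this, of euclidean Re]
    show "continuous_map ?X euclidean (\<lambda>x. Re (\<tau> (adj z o\<^sub>L x)))"
      by (simp add: o_def continuous_intros)
  qed simp
  then have "closedin ?X (\<Inter>z\<in>M. ?C z)"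
    using vna_id[OF vna] by (intro closedin_INT) auto
  moreover have "(\<Inter>z\<in>M. ?C z) = {x \<in> topspace ?X. L2_square x \<le> s}"
  proof (intro equalityI subsetI)
    fix x assume "x \<in> {x \<in> topspace ?X. L2_square x \<le> s}"
    then have x: "x \<in> M" "L2_square x \<le> s" by auto
    \<comment> \<open>This is \<open>0 \<le> L2_square (x - z)\<close> expanded.\<close>
    have "Re (\<tau> (adj z o\<^sub>L x)) \<le> (s + L2_square z) / 2" if "z \<in> M" for z
      using trace_square_nonneg(2)[of "x - z"] L2_square_diff[of x z] x that closure by fastforce
    then show "x \<in> (\<Inter>z\<in>M. ?C z)" using x by auto
  next
    fix x assume x: "x \<in> (\<Inter>z\<in>M. ?C z)"
    then have "x \<in> M" using vna_id[OF vna] by auto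
    \<comment> \<open>The condition for \<open>z = x\<close> is already the claim.\<close>
    with x show "x \<in> {x \<in> topspace ?X. L2_square x \<le> s}"
      by (auto simp: L2_square_def)
  qed
  ultimately show ?thesis by simp
qed

theorem tracial_functional_unique:
  assumes center: "M \<inter> commutant M = range (\<lambda>c. c *\<^sub>C id_blinfun)"
    and \<psi>: "\<psi> \<in> predual M" and tracial: "\<And>x y. x \<in> M \<Longrightarrow> y \<in> M \<Longrightarrow> \<psi> (x o\<^sub>L y) = \<psi> (y o\<^sub>L x)"
    and x: "x \<in> M"
  shows "\<psi> x = \<tau> x * \<psi> id_blinfun"
proof -
  let ?X = "subtopology ultraweak M"
  have \<psi>_linear: "linear_functional_on M \<psi>" using \<psi> by (simp add: predual_def)
  have \<tau>: "\<tau> \<in> predual M" "\<And>x y. x \<in> M \<Longrightarrow> y \<in> M \<Longrightarrow> \<tau> (x o\<^sub>L y) = \<tau> (y o\<^sub>L x)"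
    "\<tau> id_blinfun = 1"
    using tr by (auto simp: trace_on_def)
  \<comment> \<open>Both functionals are frozen on \<open>K\<close>, so a scalar in \<open>K\<close>
    will reveal both values at \<open>x\<close>.\<close>
  define K where "K = {y \<in> M. norm y \<le> norm x \<and> \<psi> y = \<psi> x \<and> \<tau> y = \<tau> x}"
  have "compactin ultraweak (op_ball (norm x) \<inter> M)"
    by (intro compact_Int_closedin compactin_op_ball closedin_vna[OF vna]) simp
  then have ball: "compactin ?X (op_ball (norm x) \<inter> M)"
    by (simp add: compactin_subtopology)
  have level: "closedin ?X {y \<in> topspace ?X. \<rho> y \<in> {\<rho> x}}" if "\<rho> \<in> predual M" for \<rho>
    using that by (intro closedin_continuous_map_preimage[of _ euclidean]) (auto simp: predual_def)
  have "K = (op_ball (norm x) \<inter> M) \<inter>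
      ({y \<in> topspace ?X. \<psi> y \<in> {\<psi> x}} \<inter> {y \<in> topspace ?X. \<tau> y \<in> {\<tau> x}})"
    by (auto simp: K_def op_ball_def vna_bounded_ops[OF vna])
  then have "compactin ?X K"
    using compact_Int_closedin[OF ball closedin_Int[OF level[OF \<psi>] level[OF \<tau>(1)]]] by simp
  moreover have "K \<noteq> {}" using x by (auto simp: K_def)
  ultimately obtain y where y: "y \<in> K" and min: "\<And>z. z \<in> K \<Longrightarrow> L2_square y \<le> L2_square z"
    using compactin_attains_min[OF _ _ closedin_L2_ball] by blast
  have yM: "y \<in> M" using y by (simp add: K_def)
  have unique: "z = y" if z: "z \<in> K" "L2_square z = L2_square y" for z
  proof -
    have zM: "z \<in> M" using z by (simp add: K_def)
    \<comment> \<open>The midpoint of two minimizers stays in \<open>K\<close>, and by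
      \<open>L2_square_midpoint\<close> it would have a smaller value if they differed.\<close>
    have "norm ((1/2) *\<^sub>C (y + z)) \<le> norm x"
      using norm_triangle_ineq[of y z] y z by (simp add: norm_scaleC K_def)
    then have "(1/2) *\<^sub>C (y + z) \<in> K"
      using y z by (auto simp: K_def closure linear_add[OF trace_linear] linear_scaleC[OF trace_linear]
          linear_add[OF \<psi>_linear] linear_scaleC[OF \<psi>_linear])
    then have "L2_square (y - z) \<le> 0"
      using min L2_square_midpoint[OF yM zM] z(2) by fastforce
    then have "L2_square (y - z) = 0"
      using trace_square_nonneg(2)[of "y - z"] closure(5)[OF yM zM] by simp
    then show ?thesis using L2_square_eq_0 closure(5)[OF yM zM] by fastforce
  qed
  have "y o\<^sub>L u = u o\<^sub>L y" if u: "u \<in> M" "unitary_op u" for u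
  proof -
    \<comment> \<open>The conjugate of \<open>y\<close> stays in \<open>K\<close> with the same
      \<open>L2_square\<close>, so uniqueness of the minimizer makes it equal to
      \<open>y\<close>.\<close>
    define z where "z = u o\<^sub>L (y o\<^sub>L adj u)"
    have uu: "adj u o\<^sub>L u = id_blinfun" "u o\<^sub>L adj u = id_blinfun"
      using u by (auto simp: unitary_op_def)
    have zM: "z \<in> M" unfolding z_def using u(1) yM by (intro closure)
    have inv: "\<rho> (u o\<^sub>L (w o\<^sub>L adj u)) = \<rho> w"
      if "\<And>x y. x \<in> M \<Longrightarrow> y \<in> M \<Longrightarrow> \<rho> (x o\<^sub>L y) = \<rho> (y o\<^sub>L x)" "w \<in> M" for \<rho> :: "_ \<Rightarrow> complex" and w
    proof -
      \<comment> \<open>Traciality moves \<open>u\<close> to the far right, where it cancels against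
        \<open>adj u\<close>.\<close>
      have "\<rho> (u o\<^sub>L (w o\<^sub>L adj u)) = \<rho> ((w o\<^sub>L adj u) o\<^sub>L u)"
        by (rule that(1)) (use u that(2) in \<open>auto intro: closure\<close>)
      then show ?thesis by (simp add: compose_assoc uu)
    qed
    have "norm z \<le> norm u * (norm y * norm (adj u))"
      unfolding z_def by (meson norm_blinfun_compose mult_left_mono norm_ge_zero order_trans)
    also have "\<dots> \<le> 1 * (norm y * 1)"
      by (intro mult_mono norm_unitary_le u) auto
    finally have "z \<in> K"
      using y zM inv[of \<psi>, OF tracial yM] inv[of \<tau>, OF \<tau>(2) yM] by (auto simp: K_def z_def)
    moreover have "L2_square z = L2_square y"
    proof -
      have "adj z = u o\<^sub>L (adj y o\<^sub>L adj u)"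
        unfolding z_def using u(1) yM
        by (simp add: adj_compose adj_adj vna_bounded_ops[OF vna] closure compose_assoc)
      then have "adj z o\<^sub>L z = u o\<^sub>L ((adj y o\<^sub>L ((adj u o\<^sub>L u) o\<^sub>L y)) o\<^sub>L adj u)"
        by (simp only: z_def compose_assoc)
      also have "\<dots> = u o\<^sub>L ((adj y o\<^sub>L y) o\<^sub>L adj u)" by (simp add: uu)
      finally show ?thesis
        using inv[of \<tau>, OF \<tau>(2), of "adj y o\<^sub>L y"] yM by (simp add: L2_square_def closure)
    qed
    ultimately have "y = u o\<^sub>L (y o\<^sub>L adj u)" using unique unfolding z_def by metis
    then have "y o\<^sub>L u = (u o\<^sub>L (y o\<^sub>L adj u)) o\<^sub>L u" by simp
    then show ?thesis by (simp add: compose_assoc uu)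
  qed
  then have "y \<in> commutant M"
    by (intro commutant_if_commute_unitaries vna vna_bounded_ops[OF vna yM])
  then obtain c where c: "y = c *\<^sub>C id_blinfun" using center yM by blast
  \<comment> \<open>Membership of \<open>c *\<^sub>C id_blinfun\<close> in \<open>K\<close> gives
    both values.\<close>
  have "\<psi> x = c * \<psi> id_blinfun" "\<tau> x = c"
    using y vna_id[OF vna] \<tau>(3) unfolding K_def c
    by (auto simp: linear_scaleC[OF trace_linear] linear_scaleC[OF \<psi>_linear])
  then show ?thesis by simp
qed

end

section \<open>Independence for gauge cocycles\<close>

theorem proposition6p2:
  fixes M :: "('h::complex_hilbert_space \<Rightarrow>\<^sub>L 'h) set"
    and \<tau> :: "('h \<Rightarrow>\<^sub>L 'h) \<Rightarrow> complex"
    and \<alpha> :: "real \<Rightarrow> ('h \<Rightarrow>\<^sub>L 'h) \<Rightarrow> ('h \<Rightarrow>\<^sub>L 'h)"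
    and U :: "real \<Rightarrow> ('h \<Rightarrow>\<^sub>L 'h)"
  assumes "II1_factor M"
    and "trace_on M \<tau>"
    and "E0_semigroup M \<alpha>"
    and "gauge_cocycle M \<alpha> U"
  shows "\<forall>x\<in>M. \<forall>t\<ge>0. \<tau> (U t o\<^sub>L \<alpha> t x) = \<tau> (U t) * \<tau> (\<alpha> t x)"
proof (intro ballI allI impI)
  fix x t assume x: "x \<in> M" and t: "(0 :: real) \<le> t"
  have vna: "von_neumann_algebra M" and center: "M \<inter> commutant M = range (\<lambda>c. c *\<^sub>C id_blinfun)"
    using assms(1) by (auto simp: II1_factor_def factor_def)
  have \<alpha>: "normal_unital_star_endomorphism M (\<alpha> t)"
    using assms(3) t by (simp add: E0_semigroup_def)
  have \<alpha>_M: "\<alpha> t y \<in> M" and \<alpha>_compose: "z \<in> M \<Longrightarrow> \<alpha> t (y o\<^sub>L z) = \<alpha> t y o\<^sub>L \<alpha> t z"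
    if "y \<in> M" for y z
    using \<alpha> that by (auto simp: normal_unital_star_endomorphism_def)
  have \<alpha>_id: "\<alpha> t id_blinfun = id_blinfun"
    using \<alpha> by (auto simp: normal_unital_star_endomorphism_def)
  have U: "U t \<in> M" and U_commute: "\<And>y. y \<in> M \<Longrightarrow> U t o\<^sub>L \<alpha> t y = \<alpha> t y o\<^sub>L U t"
    using assms(4) t by (auto simp: gauge_cocycle_def commutant_def)
  have \<tau>: "\<tau> \<in> predual M" "\<And>x y. x \<in> M \<Longrightarrow> y \<in> M \<Longrightarrow> \<tau> (x o\<^sub>L y) = \<tau> (y o\<^sub>L x)"
    "\<tau> id_blinfun = 1"
    using assms(2) by (auto simp: trace_on_def)
  note unique = tracial_functional_unique[OF vna assms(2) center _ _ x]
  \<comment> \<open>Since \<open>\<alpha> t\<close> is unital, this says that it preserves the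
    trace.\<close>
  have "\<tau> (\<alpha> t x) = \<tau> x * \<tau> (\<alpha> t id_blinfun)"
    by (rule unique[OF predual_endomorphism[OF \<tau>(1) \<alpha>]]) (simp add: \<alpha>_compose \<tau>(2) \<alpha>_M)
  moreover have "\<tau> (U t o\<^sub>L \<alpha> t x) = \<tau> x * \<tau> (U t o\<^sub>L \<alpha> t id_blinfun)"
  proof (rule unique[OF predual_endomorphism[OF predual_compose_left[OF vna \<tau>(1) U] \<alpha>]])
    fix y z assume y: "y \<in> M" and z: "z \<in> M"
    \<comment> \<open>The gauge condition moves \<open>U t\<close> past \<open>\<alpha> t y\<close>;
      cyclicity of the trace then brings \<open>\<alpha> t y\<close> to the right end.\<close>
    have "\<tau> (U t o\<^sub>L \<alpha> t (y o\<^sub>L z)) = \<tau> (\<alpha> t y o\<^sub>L (U t o\<^sub>L \<alpha> t z))"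
      using U_commute[OF y] by (simp add: \<alpha>_compose y z flip: compose_assoc)
    also have "\<dots> = \<tau> ((U t o\<^sub>L \<alpha> t z) o\<^sub>L \<alpha> t y)"
      by (intro \<tau>(2) vna_compose[OF vna] \<alpha>_M U y z)
    finally show "\<tau> (U t o\<^sub>L \<alpha> t (y o\<^sub>L z)) = \<tau> (U t o\<^sub>L \<alpha> t (z o\<^sub>L y))"
      by (simp add: \<alpha>_compose y z compose_assoc)
  qed
  ultimately show "\<tau> (U t o\<^sub>L \<alpha> t x) = \<tau> (U t) * \<tau> (\<alpha> t x)"
    by (simp add: \<alpha>_id \<tau>(3))
qed

end
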